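(* Let $X=\{-1,0,+1\}$, ordered in this way, and let $T_A$ be the correspondence with adjacency matrix $$A=\begin{pmatrix}1&1&1\\ 1&0&1\\ 1&1&1\end{pmatrix},$$ so that the only forbidden transition is $(0,0)$. Set $\psi(s,t)=st$ and, for $\beta\ge0$ and $\gamma\in\mathcal{M}(\Gamma_{T_A})$, $\mathcal{E}_\beta(\gamma)=\frac\beta2\bigl(\int_{\Gamma_{T_A}}st\,d\gamma(s,t)\bigr)^2$. Define $$\lambda(y)=\cosh y+\sqrt{\cosh^2y+2},\qquad z(y)=\frac{\sinh y}{\sqrt{\sinh^2y+3}}.$$ Then the critical inverse temperature is $\beta_c=\sqrt3$. For every $y\in\mathbb{R}$ the linear equilibrium pair for the potential $y\psi$ is $(\mu_y,Q_y)$ with $$Q_y=\begin{pmatrix} e^y/\lambda(y) & 2/\lambda(y)^2 & e^{-y}/\lambda(y) \\ 1/2 & 0 & 1/2 \\ e^{-y}/\lambda(y) & 2/\lambda(y)^2 & e^y/\lambda(y) \end{pmatrix},\quad\mu_y(\pm1)=\frac{\lambda(y)^2}{2(\lambda(y)^2+2)},\quad\mu_y(0)=\frac2{\lambda(y)^2+2}.$$ The nonlinear equilibrium pairs for $\mathcal{E}_\beta$ are classified as follows. (i) If $0\le\beta\le\beta_c$, there is a unique equilibrium pair, namely $(\mu_0,Q_0)$ (i.e. $y=0$), with correlation between successive states $z=0$. (ii) If $\beta>\beta_c$, there are exactly two equilibrium pairs, namely $(\mu_y,Q_y)$ for $y=\pm y_\beta$, where $y_\beta>0$ is the unique positive solution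 of $y_\beta=\beta\frac{\sinh y_\beta}{\sqrt{\sinh^2y_\beta+3}}$. Their correlations between successive states are $\pm z_\beta$, where $z_\beta:=z(y_\beta)$. In particular, for $\beta>\beta_c$ the two nonlinear equilibrium pairs have the same stationary measure on $X$ but distinct two-coordinate distributions $\gamma_y(i,j)=\mu_y(i)Q_y(i,j)$. The nonlinear pressure is $$\Pi_{\mathrm{top}}^{\mathcal{E}_\beta}(T_A)=\begin{cases}\log(1+\sqrt3),&0\le\beta\le\sqrt3,\\ \log\lambda(y_\beta)-\frac\beta2z_\beta^2,&\beta>\sqrt3.\end{cases}$$ As $\beta\downarrow\sqrt3$, $z_\beta\sim\frac{(10\sqrt3)^{1/4}}{\sqrt3}(\beta-\sqrt3)^{1/4}$. Consequently the transition is continuous: the pressure, as a function of $\beta$, is $C^1$ and is not $C^2$ at $\beta=\sqrt3$.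
   Context: Finite-state conventions. A zero-one matrix $A=(a_{ij})$ without zero rows, indexed by a finite set $X$ (discrete metric), defines the correspondence $T_A(i)=\{j:a_{ij}=1\}$, with $\Gamma_{T_A}=\{(i,j):a_{ij}=1\}$. $\mathcal{M}(\Gamma_{T_A})$ is the set of probability vectors on $\Gamma_{T_A}$. A stationary transition pair $(\mu,Q)$ consists of a stochastic matrix $Q$ with $Q(i,j)=0$ if $a_{ij}=0$ and a probability vector $\mu$ with $\sum_i\mu(i)Q(i,j)=\mu(j)$. Its two-coordinate distribution is $\gamma_{\mu,Q}(i,j)=\mu(i)Q(i,j)$; its correlation between successive states is $\int st\,d\gamma_{\mu,Q}(s,t)$; $h_\mu(Q)$ is the entropy rate of the stationary Markov chain, $h_\mu(Q)=-\sum_{i,j}\mu(i)Q(i,j)\log Q(i,j)$ ($0\log0=0$; natural logarithms). For a continuous energy $\mathcal{E}$ on $\mathcal{M}(\Gamma_{T_A})$, a nonlinear equilibrium pair is a stationary transition pair maximizing $h_\mu(Q)+\mathcal{E}(\gamma_{\mu,Q})$ among all stationary transition pairs; a linear equilibrium pair for a potential $\varphi:\Gamma_{T_A}\to\mathbb{R}$ is one maximizing $h_\mu(Q)+\int\varphi\,d\gamma_{\mu,Q}$. Kernels agreeing $\mu$-a.e. are identified. Nonlinear pressure: for a path $\boldsymbol{x}=(x_0,\dots,x_n)$ with $x_{j+1}\in T_A(x_j)$, let $L_n(\boldsymbol{x})=\frac1n\sum_{j=0}^{n-1}\delta_{(x_j,x_{j+1})}$; then $\Pi_{\mathrm{top}}^{\mathcal{E}}(T_A)=\lim_{n\to\infty}\frac1n\log\sum_{\boldsymbol{x}}\exp(n\mathcal{E}(L_n(\boldsymbol{x})))$,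 the sum over all such paths. The critical inverse temperature is the value of $\beta$ separating the regime with a unique equilibrium pair from the regime with several. $f\sim g$ means $f/g\to1$. *)

theory Defs
  imports "HOL-Analysis.Analysis" "HOL-Library.Landau_Symbols"
begin

section \<open>Finite-state transition correspondences\<close>

text \<open>
  The state space is a finite type, and a matrix over it is a curried function whose first
  argument is the row index.
\<close>

definition zero_one_matrix :: "('a \<Rightarrow> 'a \<Rightarrow> nat) \<Rightarrow> bool" where
  "zero_one_matrix A \<longleftrightarrow> (\<forall>i j. A i j \<in> {0, 1}) \<and> (\<forall>i. \<exists>j. A i j \<noteq> 0)"

definition correspondence :: "('a \<Rightarrow> 'a \<Rightarrow> nat) \<Rightarrow> 'a \<Rightarrow> 'a set" where
  "correspondence A i = {j. A i j = 1}"

definition corr_graph :: "('a \<Rightarrow> 'a \<Rightarrow> nat) \<Rightarrow> ('a \<times> 'a) set" where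
  "corr_graph A = {(i, j). j \<in> correspondence A i}"

definition prob_vector :: "('a::finite \<Rightarrow> real) \<Rightarrow> bool" where
  "prob_vector p \<longleftrightarrow> (\<forall>i. 0 \<le> p i) \<and> (\<Sum>i\<in>UNIV. p i) = 1"

text \<open>
  The probability vectors on the graph are represented by their extension by zero to all pairs.
  Energies are total functions on vectors indexed by pairs, but only their values on this set
  matter below; see \<open>two_coordinate_law_in_graph_laws\<close> and \<open>empirical_law_in_graph_laws\<close>.
\<close>

definition graph_laws :: "('a::finite \<Rightarrow> 'a \<Rightarrow> nat) \<Rightarrow> ('a \<times> 'a \<Rightarrow> real) set" where
  "graph_laws A = {g. prob_vector g \<and> (\<forall>e. e \<notin> corr_graph A \<longrightarrow> g e = 0)}"

definition graph_integral ::
    "('a::finite \<Rightarrow> 'a \<Rightarrow> nat) \<Rightarrow> ('a \<times> 'a \<Rightarrow> real) \<Rightarrow> ('a \<times> 'a \<Rightarrow> real) \<Rightarrow> real" where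
  "graph_integral A f g = (\<Sum>e\<in>corr_graph A. f e * g e)"


section \<open>Stationary transition pairs\<close>

type_synonym 'a transition_pair = "('a \<Rightarrow> real) \<times> ('a \<Rightarrow> 'a \<Rightarrow> real)"

definition stationary_pair :: "('a::finite \<Rightarrow> 'a \<Rightarrow> nat) \<Rightarrow> 'a transition_pair \<Rightarrow> bool" where
  "stationary_pair A = (\<lambda>(\<mu>, Q).
     prob_vector \<mu> \<and> (\<forall>i. prob_vector (Q i)) \<and>
     (\<forall>i j. A i j = 0 \<longrightarrow> Q i j = 0) \<and>
     (\<forall>j. (\<Sum>i\<in>UNIV. \<mu> i * Q i j) = \<mu> j))"

definition two_coordinate_law :: "'a transition_pair \<Rightarrow> 'a \<times> 'a \<Rightarrow> real" where
  "two_coordinate_law = (\<lambda>(\<mu>, Q) (i, j). \<mu> i * Q i j)"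

text \<open>The convention \<open>0 log 0 = 0\<close> holds since \<open>0 * x = 0\<close> for every real \<open>x\<close>.\<close>

definition entropy_rate :: "'a::finite transition_pair \<Rightarrow> real" where
  "entropy_rate = (\<lambda>(\<mu>, Q). - (\<Sum>i\<in>UNIV. \<Sum>j\<in>UNIV. \<mu> i * Q i j * ln (Q i j)))"

definition equilibrium_pair ::
    "('a::finite \<Rightarrow> 'a \<Rightarrow> nat) \<Rightarrow> (('a \<times> 'a \<Rightarrow> real) \<Rightarrow> real) \<Rightarrow> 'a transition_pair \<Rightarrow> bool" where
  "equilibrium_pair A E p \<longleftrightarrow> stationary_pair A p \<and>
     (\<forall>q. stationary_pair A q \<longrightarrow>
        entropy_rate q + E (two_coordinate_law q) \<le> entropy_rate p + E (two_coordinate_law p))"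

definition linear_equilibrium_pair ::
    "('a::finite \<Rightarrow> 'a \<Rightarrow> nat) \<Rightarrow> ('a \<times> 'a \<Rightarrow> real) \<Rightarrow> 'a transition_pair \<Rightarrow> bool" where
  "linear_equilibrium_pair A \<phi> = equilibrium_pair A (graph_integral A \<phi>)"

text \<open>Kernels agreeing almost everywhere for the stationary measure are identified.\<close>

definition same_pair :: "'a transition_pair \<Rightarrow> 'a transition_pair \<Rightarrow> bool" where
  "same_pair = (\<lambda>(\<mu>, Q) (\<nu>, R). \<mu> = \<nu> \<and> (\<forall>i. \<mu> i \<noteq> 0 \<longrightarrow> Q i = R i))"

text \<open>All counting of pairs is up to this identification.\<close>

definition only_pair :: "('a transition_pair \<Rightarrow> bool) \<Rightarrow> 'a transition_pair \<Rightarrow> bool" where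
  "only_pair P p \<longleftrightarrow> P p \<and> (\<forall>q. P q \<longrightarrow> same_pair q p)"

definition several_pairs :: "('a transition_pair \<Rightarrow> bool) \<Rightarrow> bool" where
  "several_pairs P \<longleftrightarrow> (\<exists>p q. P p \<and> P q \<and> \<not> same_pair p q)"

definition only_two_pairs ::
    "('a transition_pair \<Rightarrow> bool) \<Rightarrow> 'a transition_pair \<Rightarrow> 'a transition_pair \<Rightarrow> bool" where
  "only_two_pairs P p q \<longleftrightarrow> P p \<and> P q \<and> \<not> same_pair p q \<and>
     (\<forall>r. P r \<longrightarrow> same_pair r p \<or> same_pair r q)"

text \<open>
  For a family of energies indexed by \<open>\<beta> \<ge> 0\<close>, the value separating the regime with a unique
  equilibrium pair from the regime with several.  What happens at the value itself is left open.
\<close>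

definition critical_inverse_temperature ::
    "('a::finite \<Rightarrow> 'a \<Rightarrow> nat) \<Rightarrow> (real \<Rightarrow> ('a \<times> 'a \<Rightarrow> real) \<Rightarrow> real) \<Rightarrow> real \<Rightarrow> bool" where
  "critical_inverse_temperature A E b \<longleftrightarrow> 0 \<le> b \<and>
     (\<forall>\<beta>. 0 \<le> \<beta> \<and> \<beta> < b \<longrightarrow> (\<exists>p. only_pair (equilibrium_pair A (E \<beta>)) p)) \<and>
     (\<forall>\<beta>. b < \<beta> \<longrightarrow> several_pairs (equilibrium_pair A (E \<beta>)))"


section \<open>Nonlinear pressure\<close>

text \<open>A path \<open>(x\<^sub>0, \<dots>, x\<^sub>n)\<close> is a list of length \<open>n + 1\<close>.\<close>

definition corr_paths :: "('a \<Rightarrow> 'a \<Rightarrow> nat) \<Rightarrow> nat \<Rightarrow> 'a list set" where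
  "corr_paths A n =
     {xs. length xs = n + 1 \<and> (\<forall>j<n. xs ! (j + 1) \<in> correspondence A (xs ! j))}"

definition empirical_law :: "nat \<Rightarrow> 'a list \<Rightarrow> 'a \<times> 'a \<Rightarrow> real" where
  "empirical_law n xs e = 1 / real n * (\<Sum>j<n. of_bool ((xs ! j, xs ! (j + 1)) = e))"

definition pressure_seq ::
    "('a::finite \<Rightarrow> 'a \<Rightarrow> nat) \<Rightarrow> (('a \<times> 'a \<Rightarrow> real) \<Rightarrow> real) \<Rightarrow> nat \<Rightarrow> real" where
  "pressure_seq A E n =
     1 / real n * ln (\<Sum>xs\<in>corr_paths A n. exp (real n * E (empirical_law n xs)))"

definition nonlinear_pressure ::
    "('a::finite \<Rightarrow> 'a \<Rightarrow> nat) \<Rightarrow> (('a \<times> 'a \<Rightarrow> real) \<Rightarrow> real) \<Rightarrow> real" where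
  "nonlinear_pressure A E = lim (pressure_seq A E)"


section \<open>Continuous differentiability on subsets of the line\<close>

text \<open>
  Derivatives are taken within the set, so they are one-sided at endpoints belonging to it.
\<close>

fun C_k_on :: "nat \<Rightarrow> (real \<Rightarrow> real) \<Rightarrow> real set \<Rightarrow> bool" where
  "C_k_on 0 f S \<longleftrightarrow> continuous_on S f"
| "C_k_on (Suc k) f S \<longleftrightarrow>
     (\<exists>f'. (\<forall>x\<in>S. (f has_real_derivative f' x) (at x within S)) \<and> C_k_on k f' S)"

definition C_k_at :: "nat \<Rightarrow> (real \<Rightarrow> real) \<Rightarrow> real \<Rightarrow> bool" where
  "C_k_at k f x \<longleftrightarrow> (\<exists>U. open U \<and> x \<in> U \<and> C_k_on k f U)"


section \<open>The three-state model\<close>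

text \<open>
  The states \<open>-1\<close>, \<open>0\<close>, \<open>+1\<close>.  Since \<open>case_spin a b c\<close> is the vector with entries \<open>a, b, c\<close> in
  this order, nesting it displays a matrix by its rows.
\<close>

datatype spin = Minus | Zero | Plus

lemma UNIV_spin: "UNIV = {Minus, Zero, Plus}"
  using spin.exhaust by auto

instance spin :: finite
  by standard (simp add: UNIV_spin)

definition spin_value :: "spin \<Rightarrow> real" where
  "spin_value = case_spin (- 1) 0 1"

definition spin_adj :: "spin \<Rightarrow> spin \<Rightarrow> nat" where
  "spin_adj = case_spin
     (case_spin 1 1 1)
     (case_spin 1 0 1)
     (case_spin 1 1 1)"

definition spin_product :: "spin \<times> spin \<Rightarrow> real" where
  "spin_product = (\<lambda>(s, t). spin_value s * spin_value t)"

definition spin_energy :: "real \<Rightarrow> (spin \<times> spin \<Rightarrow> real) \<Rightarrow> real" where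
  "spin_energy \<beta> g = \<beta> / 2 * (graph_integral spin_adj spin_product g)\<^sup>2"

definition correlation :: "spin transition_pair \<Rightarrow> real" where
  "correlation p = graph_integral spin_adj spin_product (two_coordinate_law p)"

definition spin_lambda :: "real \<Rightarrow> real" where
  "spin_lambda y = cosh y + sqrt ((cosh y)\<^sup>2 + 2)"

definition spin_z :: "real \<Rightarrow> real" where
  "spin_z y = sinh y / sqrt ((sinh y)\<^sup>2 + 3)"

definition spin_kernel :: "real \<Rightarrow> spin \<Rightarrow> spin \<Rightarrow> real" where
  "spin_kernel y = case_spin
     (case_spin (exp y / spin_lambda y) (2 / (spin_lambda y)\<^sup>2) (exp (- y) / spin_lambda y))
     (case_spin (1 / 2) 0 (1 / 2))
     (case_spin (exp (- y) / spin_lambda y) (2 / (spin_lambda y)\<^sup>2) (exp y / spin_lambda y))"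

definition spin_measure :: "real \<Rightarrow> spin \<Rightarrow> real" where
  "spin_measure y = case_spin
     ((spin_lambda y)\<^sup>2 / (2 * ((spin_lambda y)\<^sup>2 + 2)))
     (2 / ((spin_lambda y)\<^sup>2 + 2))
     ((spin_lambda y)\<^sup>2 / (2 * ((spin_lambda y)\<^sup>2 + 2)))"

definition spin_pair :: "real \<Rightarrow> spin transition_pair" where
  "spin_pair y = (spin_measure y, spin_kernel y)"

definition self_consistent :: "real \<Rightarrow> real \<Rightarrow> bool" where
  "self_consistent \<beta> y \<longleftrightarrow> 0 < y \<and> y = \<beta> * (sinh y / sqrt ((sinh y)\<^sup>2 + 3))"

text \<open>
  Meaningful for \<open>\<beta> > sqrt 3\<close> only, where existence and uniqueness are part of the claim.
\<close>

definition y_sol :: "real \<Rightarrow> real" where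
  "y_sol \<beta> = (THE y. self_consistent \<beta> y)"

definition spin_pressure :: "real \<Rightarrow> real" where
  "spin_pressure \<beta> = nonlinear_pressure spin_adj (spin_energy \<beta>)"


section \<open>Consistency of the encoding\<close>

lemma two_coordinate_law_in_graph_laws:
  assumes "zero_one_matrix A" "stationary_pair A p"
  shows "two_coordinate_law p \<in> graph_laws A"
proof -
  obtain \<mu> Q where p: "p = (\<mu>, Q)" by fastforce
  have s: "prob_vector \<mu>" "\<And>i. prob_vector (Q i)" "\<And>i j. A i j = 0 \<Longrightarrow> Q i j = 0"
    using assms(2) by (auto simp: stationary_pair_def p)
  have "(\<Sum>e\<in>UNIV. two_coordinate_law p e) = (\<Sum>i\<in>UNIV. \<Sum>j\<in>UNIV. \<mu> i * Q i j)"
    by (simp add: two_coordinate_law_def p sum.cartesian_product flip: UNIV_Times_UNIV)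
  also have "\<dots> = 1"
    using s by (simp add: prob_vector_def flip: sum_distrib_left)
  finally have "(\<Sum>e\<in>UNIV. two_coordinate_law p e) = 1" .
  moreover have "Q i j = 0" if "A i j \<noteq> 1" for i j
    using s(3)[of i j] assms(1) that
    by (metis zero_one_matrix_def insertE singletonD)
  ultimately show ?thesis
    using s(1,2)
    by (auto simp: graph_laws_def prob_vector_def two_coordinate_law_def p corr_graph_def
        correspondence_def)
qed

lemma empirical_law_in_graph_laws:
  assumes "n > 0" "xs \<in> corr_paths A n"
  shows "empirical_law n xs \<in> graph_laws A"
proof -
  have "(\<Sum>e\<in>UNIV. empirical_law n xs e) =
      1 / real n * (\<Sum>j<n. \<Sum>e\<in>UNIV. of_bool ((xs ! j, xs ! (j + 1)) = e))"
    unfolding empirical_law_def sum_distrib_left[symmetric] by (subst sum.swap) simp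
  also have "\<dots> = 1"
    using assms(1) by (simp add: of_bool_def)
  finally have "(\<Sum>e\<in>UNIV. empirical_law n xs e) = 1" .
  moreover have "empirical_law n xs e = 0" if "e \<notin> corr_graph A" for e
  proof -
    have "(xs ! j, xs ! (j + 1)) \<noteq> e" if "j < n" for j
      using assms(2) \<open>e \<notin> corr_graph A\<close> that by (auto simp: corr_paths_def corr_graph_def)
    then show ?thesis by (simp add: empirical_law_def)
  qed
  moreover have "0 \<le> empirical_law n xs e" for e
    by (auto simp: empirical_law_def intro!: divide_nonneg_nonneg sum_nonneg)
  ultimately show ?thesis
    by (simp add: graph_laws_def prob_vector_def)
qed

lemma zero_one_spin_adj: "zero_one_matrix spin_adj"
  by (auto simp: zero_one_matrix_def spin_adj_def split: spin.splits intro: exI[of _ Plus])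

lemma spin_adj_forbidden: "e \<notin> corr_graph spin_adj \<longleftrightarrow> e = (Zero, Zero)"
  by (cases e) (auto simp: corr_graph_def correspondence_def spin_adj_def split: spin.splits)

end

theory Submission
  imports Defs "HOL-Real_Asymp.Real_Asymp"
begin

text \<open>
  Let \<open>r\<close> be a positive right eigenvector, with eigenvalue \<open>\<lambda>\<close>, of the matrix \<open>exp \<phi>\<close> restricted
  to the graph, and let \<open>K i j = exp (\<phi> (i, j)) r j / (\<lambda> r i)\<close>.  By stationarity the factors
  \<open>r j / r i\<close> cancel on average, so for every stationary pair \<open>(\<mu>, Q)\<close> the entropy rate plus the
  integral of \<open>\<phi>\<close> equals \<open>ln \<lambda>\<close> minus the \<open>\<mu>\<close>-average of the relative entropies of \<open>Q i\<close> with
  respect to \<open>K i\<close>.  Gibbs' inequality then gives the linear variational principle and its equality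
  case (\<open>linear_free_energy\<close>).  For \<open>\<phi> (s, t) = y s t\<close> in the three-state model, \<open>r = (1, 2 / \<lambda> y, 1)\<close> with
  eigenvalue \<open>\<lambda> y\<close>, and \<open>K\<close> is \<open>Q\<^sub>y\<close>, whose only invariant law is \<open>\<mu>\<^sub>y\<close>.

  A pair with correlation \<open>c\<close> has nonlinear value \<open>h + \<beta> c\<^sup>2 / 2 = (h + y c) - \<beta> c\<^sup>2 / 2\<close> for
  \<open>y = \<beta> c\<close>, which is at most \<open>G c = ln (\<lambda> (\<beta> c)) - \<beta> c\<^sup>2 / 2\<close>, with equality only for
  \<open>(\<mu>\<^sub>y, Q\<^sub>y)\<close>.  Since \<open>(ln \<lambda>)' = z\<close>, the derivative of \<open>G\<close> at \<open>c\<close> is \<open>\<beta> (z (\<beta> c) - c)\<close>.  The ratio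
  \<open>z y / y\<close> decreases strictly on the positive axis from its limit \<open>1 / sqrt 3\<close> at \<open>0\<close>, so
  for \<open>y > 0\<close> the sign of \<open>\<beta> z y - y\<close> is that of \<open>Y \<beta> - y\<close>, where the branch \<open>Y \<beta>\<close> is \<open>0\<close> for \<open>\<beta> \<le> sqrt 3\<close> and the
  positive solution of the self-consistency equation otherwise (\<open>spin_branch_compare\<close>).  Hence, up
  to identification, the equilibrium pairs are the \<open>(\<mu>\<^sub>y, Q\<^sub>y)\<close> with \<open>\<bar>y\<bar> = Y \<beta>\<close>
  (\<open>spin_equilibrium\<close>).

  For the pressure, the inequality \<open>\<beta> b\<^sup>2 / 2 \<ge> \<beta> c b - \<beta> c\<^sup>2 / 2\<close>, with equality at \<open>c = b\<close>,
  bounds the partition sum from below by a tilted one and from above by the sum of the tilted ones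
  over the \<open>2 n + 1\<close> possible values of the correlation of a path.  Tilted sums are computed up to
  bounded factors by the eigenvector \<open>r\<close>, so the limit is the maximum of \<open>G\<close>.

  By the variational principle the pressure is a maximum of functions affine in \<open>\<beta>\<close>, so
  \<open>z\<^sup>2 / 2\<close> at the branch is a subgradient.  The branch is continuous in \<open>\<beta>\<close>, because for
  \<open>a > 0\<close> the conditions \<open>a < Y \<beta>\<close> and \<open>Y \<beta> < a\<close> are the open conditions \<open>a < \<beta> z a\<close> and
  \<open>\<beta> z a < a\<close>; a continuous subgradient is a derivative.  Finally
  \<open>1 - sqrt 3 z y / y \<sim> y\<^sup>4 / 30\<close> at \<open>0\<close> turns \<open>Y = \<beta> z Y\<close> into
  \<open>(Y \<beta>)\<^sup>4 \<sim> 10 sqrt 3 (\<beta> - sqrt 3)\<close>, and the derivative of the pressure grows like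
  \<open>(\<beta> - sqrt 3) powr (1 / 2)\<close>, which has infinite slope at \<open>sqrt 3\<close>.
\<close>

section \<open>Gibbs' inequality and the linear variational principle\<close>

lemma gibbs_term:
  fixes p q :: real
  assumes "0 \<le> p" "0 \<le> q" "q = 0 \<Longrightarrow> p = 0"
  shows "0 \<le> q - p - p * ln q + p * ln p"
    and "q - p - p * ln q + p * ln p = 0 \<Longrightarrow> p = q"
proof -
  consider "p = 0" | "p > 0" "q > 0"
    using assms by fastforce
  then have "0 \<le> q - p - p * ln q + p * ln p \<and>
      (q - p - p * ln q + p * ln p = 0 \<longrightarrow> p = q)"
  proof cases
    case 1
    then show ?thesis using assms(2) by simp
  next
    case 2
    have e: "q - p - p * ln q + p * ln p = p * (q / p - 1 - ln (q / p))"
      using 2 by (simp add: ln_div field_simps)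
    have "ln (q / p) \<le> q / p - 1"
      using 2 by (intro ln_le_minus_one) simp
    moreover have "q / p = 1" if "ln (q / p) = q / p - 1"
      using 2 that by (intro ln_eq_minus_one) simp_all
    ultimately show ?thesis
      unfolding e using 2 by auto
  qed
  then show "0 \<le> q - p - p * ln q + p * ln p"
    and "q - p - p * ln q + p * ln p = 0 \<Longrightarrow> p = q"
    by blast+
qed

lemma gibbs_inequality:
  fixes p q :: "'a::finite \<Rightarrow> real"
  assumes "prob_vector p" "prob_vector q" "\<And>i. q i = 0 \<Longrightarrow> p i = 0"
  shows "(\<Sum>i\<in>UNIV. p i * ln (q i)) \<le> (\<Sum>i\<in>UNIV. p i * ln (p i))"
    and "(\<Sum>i\<in>UNIV. p i * ln (q i)) = (\<Sum>i\<in>UNIV. p i * ln (p i)) \<Longrightarrow> p = q"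
proof -
  let ?t = "\<lambda>i. q i - p i - p i * ln (q i) + p i * ln (p i)"
  have nn: "0 \<le> ?t i" for i
    by (rule gibbs_term(1)) (use assms in \<open>auto simp: prob_vector_def\<close>)
  have s: "(\<Sum>i\<in>UNIV. ?t i) = (\<Sum>i\<in>UNIV. p i * ln (p i)) - (\<Sum>i\<in>UNIV. p i * ln (q i))"
    using assms(1,2) by (simp add: sum.distrib sum_subtractf prob_vector_def)
  have "0 \<le> (\<Sum>i\<in>UNIV. ?t i)"
    by (intro sum_nonneg nn)
  with s show "(\<Sum>i\<in>UNIV. p i * ln (q i)) \<le> (\<Sum>i\<in>UNIV. p i * ln (p i))"
    by simp
  assume "(\<Sum>i\<in>UNIV. p i * ln (q i)) = (\<Sum>i\<in>UNIV. p i * ln (p i))"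
  with s have "(\<Sum>i\<in>UNIV. ?t i) = 0"
    by simp
  then have z: "?t i = 0" for i
    using sum_nonneg_eq_0_iff[of UNIV ?t] nn by auto
  show "p = q"
  proof
    fix i
    show "p i = q i"
      by (rule gibbs_term(2)) (use assms z[of i] in \<open>auto simp: prob_vector_def\<close>)
  qed
qed

text \<open>
  The vector \<open>r\<close> is a positive right eigenvector, with positive eigenvalue \<open>l\<close>, of the matrix
  \<open>exp (\<phi> (i, j))\<close> restricted to the graph.
\<close>

definition transfer_eigen ::
    "('a::finite \<Rightarrow> 'a \<Rightarrow> nat) \<Rightarrow> ('a \<times> 'a \<Rightarrow> real) \<Rightarrow> ('a \<Rightarrow> real) \<Rightarrow> real \<Rightarrow> bool" where
  "transfer_eigen A \<phi> r l \<longleftrightarrow> 0 < l \<and> (\<forall>i. 0 < r i) \<and>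
     (\<forall>i. (\<Sum>j\<in>correspondence A i. exp (\<phi> (i, j)) * r j) = l * r i)"

text \<open>
  The Doob transform of the weighted matrix by its eigenvector, which is the stochastic kernel
  maximizing the linear free energy.
\<close>

definition doob_kernel ::
    "('a::finite \<Rightarrow> 'a \<Rightarrow> nat) \<Rightarrow> ('a \<times> 'a \<Rightarrow> real) \<Rightarrow> ('a \<Rightarrow> real) \<Rightarrow> real \<Rightarrow>
     'a \<Rightarrow> 'a \<Rightarrow> real" where
  "doob_kernel A \<phi> r l i j =
     (if j \<in> correspondence A i then exp (\<phi> (i, j)) * r j / (l * r i) else 0)"

lemma prob_vector_doob_kernel:
  assumes "transfer_eigen A \<phi> r l"
  shows "prob_vector (doob_kernel A \<phi> r l i)"
proof -
  have pos: "0 < l" "\<And>i. 0 < r i"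
    using assms by (auto simp: transfer_eigen_def)
  have "(\<Sum>j\<in>UNIV. doob_kernel A \<phi> r l i j) =
      (\<Sum>j\<in>correspondence A i. exp (\<phi> (i, j)) * r j / (l * r i))"
    unfolding doob_kernel_def by (simp add: sum.If_cases)
  also have "\<dots> = 1"
    using assms pos(1) pos(2)[of i, THEN less_imp_neq]
    by (simp add: transfer_eigen_def flip: sum_divide_distrib)
  finally show ?thesis
    using pos by (auto simp: prob_vector_def doob_kernel_def less_imp_le)
qed

lemma notin_correspondence_iff:
  assumes "zero_one_matrix A"
  shows "j \<notin> correspondence A i \<longleftrightarrow> A i j = 0"
proof -
  have "A i j = 0 \<or> A i j = 1"
    using assms by (auto simp: zero_one_matrix_def)
  then show ?thesis
    by (auto simp: correspondence_def)
qed

lemma graph_integral_law: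
  assumes "zero_one_matrix A" "stationary_pair A (\<mu>, Q)"
  shows "graph_integral A \<phi> (two_coordinate_law (\<mu>, Q)) =
      (\<Sum>i\<in>UNIV. \<Sum>j\<in>UNIV. \<mu> i * Q i j * \<phi> (i, j))"
proof -
  have "two_coordinate_law (\<mu>, Q) e = 0" if "e \<notin> corr_graph A" for e
    using two_coordinate_law_in_graph_laws[OF assms] that
    unfolding graph_laws_def by blast
  then have "graph_integral A \<phi> (two_coordinate_law (\<mu>, Q)) =
      (\<Sum>e\<in>UNIV. \<phi> e * two_coordinate_law (\<mu>, Q) e)"
    unfolding graph_integral_def by (intro sum.mono_neutral_left) auto
  also have "\<dots> = (\<Sum>i\<in>UNIV. \<Sum>j\<in>UNIV. \<mu> i * Q i j * \<phi> (i, j))"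
    by (simp add: two_coordinate_law_def sum.cartesian_product mult_ac split_def
        flip: UNIV_Times_UNIV)
  finally show ?thesis .
qed

text \<open>
  The inner difference is minus the relative entropy of \<open>Q i\<close> with respect to the Doob kernel.
  Stationarity of \<open>\<mu>\<close> makes the contributions of \<open>ln (r j)\<close> and \<open>ln (r i)\<close> cancel.
\<close>

lemma free_energy_eq:
  assumes A: "zero_one_matrix A" and st: "stationary_pair A (\<mu>, Q)"
    and ev: "transfer_eigen A \<phi> r l"
  shows "entropy_rate (\<mu>, Q) + graph_integral A \<phi> (two_coordinate_law (\<mu>, Q)) =
      ln l + (\<Sum>i\<in>UNIV. \<mu> i * ((\<Sum>j\<in>UNIV. Q i j * ln (doob_kernel A \<phi> r l i j)) -
        (\<Sum>j\<in>UNIV. Q i j * ln (Q i j))))"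
proof -
  let ?K = "doob_kernel A \<phi> r l"
  have pos: "0 < l" "\<And>i. 0 < r i"
    using ev by (auto simp: transfer_eigen_def)
  have mu: "(\<Sum>i\<in>UNIV. \<mu> i) = 1" and Q: "\<And>i. (\<Sum>j\<in>UNIV. Q i j) = 1"
    and inv: "\<And>j. (\<Sum>i\<in>UNIV. \<mu> i * Q i j) = \<mu> j"
    and Q0: "\<And>i j. A i j = 0 \<Longrightarrow> Q i j = 0"
    using st by (auto simp: stationary_pair_def prob_vector_def)
  have "Q i j * ln (?K i j) = Q i j * (\<phi> (i, j) + ln (r j) - ln (r i) - ln l)" for i j
  proof (cases "j \<in> correspondence A i")
    case True
    have "ln (?K i j) = \<phi> (i, j) + ln (r j) - ln (r i) - ln l"
      using True pos(1) pos(2)[of i] pos(2)[of j]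
      by (simp add: doob_kernel_def ln_div ln_mult)
    then show ?thesis by simp
  next
    case False
    then have "A i j = 0"
      using notin_correspondence_iff[OF A] by blast
    then show ?thesis by (simp add: Q0)
  qed
  then have "(\<Sum>i\<in>UNIV. \<mu> i * (\<Sum>j\<in>UNIV. Q i j * ln (?K i j))) =
      (\<Sum>i\<in>UNIV. \<mu> i * (\<Sum>j\<in>UNIV. Q i j * (\<phi> (i, j) + ln (r j) - ln (r i) - ln l)))"
    by presburger
  also have "\<dots> =
      (\<Sum>i\<in>UNIV. \<Sum>j\<in>UNIV. \<mu> i * Q i j * \<phi> (i, j)) +
      (\<Sum>i\<in>UNIV. \<Sum>j\<in>UNIV. \<mu> i * Q i j * ln (r j)) -
      (\<Sum>i\<in>UNIV. \<mu> i * (ln (r i) + ln l) * (\<Sum>j\<in>UNIV. Q i j))"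
    by (simp add: sum_distrib_left sum.distrib sum_subtractf algebra_simps)
  also have "(\<Sum>i\<in>UNIV. \<Sum>j\<in>UNIV. \<mu> i * Q i j * ln (r j)) = (\<Sum>j\<in>UNIV. \<mu> j * ln (r j))"
    by (subst sum.swap) (simp add: inv flip: sum_distrib_right)
  also have "(\<Sum>i\<in>UNIV. \<mu> i * (ln (r i) + ln l) * (\<Sum>j\<in>UNIV. Q i j)) =
      (\<Sum>j\<in>UNIV. \<mu> j * ln (r j)) + ln l"
    by (simp add: Q mu distrib_left sum.distrib flip: sum_distrib_right)
  finally show ?thesis
    unfolding graph_integral_law[OF A st]
    by (simp add: entropy_rate_def right_diff_distrib sum_subtractf sum_distrib_left mult_ac)
qed

lemma linear_free_energy:
  assumes A: "zero_one_matrix A" and st: "stationary_pair A (\<mu>, Q)"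
    and ev: "transfer_eigen A \<phi> r l"
  shows "entropy_rate (\<mu>, Q) + graph_integral A \<phi> (two_coordinate_law (\<mu>, Q)) \<le> ln l"
    and "entropy_rate (\<mu>, Q) + graph_integral A \<phi> (two_coordinate_law (\<mu>, Q)) = ln l \<longleftrightarrow>
      (\<forall>i. \<mu> i \<noteq> 0 \<longrightarrow> Q i = doob_kernel A \<phi> r l i)"
proof -
  let ?K = "doob_kernel A \<phi> r l"
  let ?d = "\<lambda>i. (\<Sum>j\<in>UNIV. Q i j * ln (Q i j)) - (\<Sum>j\<in>UNIV. Q i j * ln (?K i j))"
  have pos: "0 < l" "\<And>i. 0 < r i"
    using ev by (auto simp: transfer_eigen_def)
  have s: "0 \<le> \<mu> i" "prob_vector (Q i)" "A i j = 0 \<Longrightarrow> Q i j = 0" for i j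
    using st by (auto simp: stationary_pair_def prob_vector_def)
  have abs: "?K i j = 0 \<Longrightarrow> Q i j = 0" for i j
  proof -
    assume "?K i j = 0"
    then have "j \<notin> correspondence A i"
      using pos(1) pos(2)[of i] pos(2)[of j] by (auto simp: doob_kernel_def)
    then have "A i j = 0"
      using notin_correspondence_iff[OF A] by blast
    then show ?thesis by (rule s)
  qed
  note g = gibbs_inequality[OF s(2) prob_vector_doob_kernel[OF ev] abs]
  have nn: "0 \<le> \<mu> i * ?d i" for i
    using s(1) g(1)[of i] by simp
  have e: "entropy_rate (\<mu>, Q) + graph_integral A \<phi> (two_coordinate_law (\<mu>, Q)) =
      ln l - (\<Sum>i\<in>UNIV. \<mu> i * ?d i)"
    unfolding free_energy_eq[OF A st ev] by (simp add: right_diff_distrib sum_subtractf)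
  show "entropy_rate (\<mu>, Q) + graph_integral A \<phi> (two_coordinate_law (\<mu>, Q)) \<le> ln l"
    unfolding e using sum_nonneg[of UNIV "\<lambda>i. \<mu> i * ?d i"] nn by simp
  have d: "?d i = 0 \<longleftrightarrow> Q i = ?K i" for i
    using g(2)[of i] by (metis cancel_comm_monoid_add_class.diff_cancel eq_iff_diff_eq_0)
  have "(\<Sum>i\<in>UNIV. \<mu> i * ?d i) = 0 \<longleftrightarrow> (\<forall>i. \<mu> i * ?d i = 0)"
    using nn by (subst sum_nonneg_eq_0_iff) auto
  also have "\<dots> \<longleftrightarrow> (\<forall>i. \<mu> i \<noteq> 0 \<longrightarrow> Q i = ?K i)"
    unfolding mult_eq_0_iff d by blast
  finally show "entropy_rate (\<mu>, Q) + graph_integral A \<phi> (two_coordinate_law (\<mu>, Q)) = ln l \<longleftrightarrow>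
      (\<forall>i. \<mu> i \<noteq> 0 \<longrightarrow> Q i = ?K i)"
    unfolding e by simp
qed

section \<open>Path sums\<close>

lemma corr_paths_Suc:
  "bij_betw (\<lambda>(xs, j). xs @ [j]) (SIGMA xs:corr_paths A n. correspondence A (xs ! n))
     (corr_paths A (Suc n))"
proof (rule bij_betw_byWitness[where f' = "\<lambda>xs. (butlast xs, last xs)"])
  show "(\<lambda>(xs, j). xs @ [j]) ` (SIGMA xs:corr_paths A n. correspondence A (xs ! n))
      \<subseteq> corr_paths A (Suc n)"
    by (auto simp: corr_paths_def nth_append less_Suc_eq)
  show "(\<lambda>xs. (butlast xs, last xs)) ` corr_paths A (Suc n)
      \<subseteq> (SIGMA xs:corr_paths A n. correspondence A (xs ! n))"
  proof (clarsimp, intro conjI)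
    fix xs assume xs: "xs \<in> corr_paths A (Suc n)"
    then show "butlast xs \<in> corr_paths A n"
      by (auto simp: corr_paths_def nth_butlast)
    have "length xs = n + 2"
      using xs by (simp add: corr_paths_def)
    then have "last xs = xs ! Suc n" "butlast xs ! n = xs ! n"
      by (simp_all add: last_conv_nth nth_butlast flip: length_0_conv)
    then show "last xs \<in> correspondence A (butlast xs ! n)"
      using xs by (auto simp: corr_paths_def)
  qed
  show "\<forall>a'\<in>corr_paths A (Suc n).
      (case (butlast a', last a') of (xs, j) \<Rightarrow> xs @ [j]) = a'"
    by (auto simp: corr_paths_def intro!: append_butlast_last_id)
qed auto

lemma finite_corr_paths: "finite (corr_paths (A :: 'a::finite \<Rightarrow> 'a \<Rightarrow> nat) n)"
  by (rule finite_subset[OF _ finite_lists_length_eq[of UNIV "n + 1"]])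
    (simp_all add: corr_paths_def subset_iff)

text \<open>
  Weighting the last state by the eigenvector makes the path sum exactly computable, since removing
  the last step multiplies it by the eigenvalue.
\<close>

lemma weighted_path_sum:
  assumes ev: "transfer_eigen A \<phi> r l"
  shows "(\<Sum>xs\<in>corr_paths A n. exp (\<Sum>j<n. \<phi> (xs ! j, xs ! (j + 1))) * r (xs ! n)) =
      l ^ n * (\<Sum>i\<in>UNIV. r i)"
proof (induction n)
  case 0
  have "bij_betw (\<lambda>i. [i]) UNIV (corr_paths A 0)"
    by (rule bij_betw_byWitness[where f' = hd]) (auto simp: corr_paths_def length_Suc_conv)
  from sum.reindex_bij_betw[OF this, of "\<lambda>xs. r (xs ! 0)"] show ?case
    by simp
next
  case (Suc n)
  let ?w = "\<lambda>xs. exp (\<Sum>j<n. \<phi> (xs ! j, xs ! (j + 1)))"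
  have "(\<Sum>xs\<in>corr_paths A (Suc n).
        exp (\<Sum>j<Suc n. \<phi> (xs ! j, xs ! (j + 1))) * r (xs ! Suc n)) =
      (\<Sum>(xs, j)\<in>(SIGMA xs:corr_paths A n. correspondence A (xs ! n)).
        ?w xs * (exp (\<phi> (xs ! n, j)) * r j))"
    by (subst sum.reindex_bij_betw[OF corr_paths_Suc, symmetric], intro sum.cong)
      (auto simp: corr_paths_def nth_append exp_add)
  also have "\<dots> = (\<Sum>xs\<in>corr_paths A n.
      ?w xs * (\<Sum>j\<in>correspondence A (xs ! n). exp (\<phi> (xs ! n, j)) * r j))"
    by (subst sum.Sigma[symmetric]) (auto simp: finite_corr_paths sum_distrib_left)
  also have "\<dots> = l * (\<Sum>xs\<in>corr_paths A n. ?w xs * r (xs ! n))"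
    using ev by (simp add: transfer_eigen_def sum_distrib_left mult_ac)
  finally show ?case
    using Suc.IH by simp
qed

lemma graph_integral_empirical_law:
  assumes "xs \<in> corr_paths A n" "0 < n"
  shows "real n * graph_integral A \<phi> (empirical_law n xs) = (\<Sum>j<n. \<phi> (xs ! j, xs ! (j + 1)))"
proof -
  have "real n * graph_integral A \<phi> (empirical_law n xs) =
      (\<Sum>e\<in>corr_graph A. \<Sum>j<n. \<phi> e * of_bool ((xs ! j, xs ! (j + 1)) = e))"
    using assms(2)
    by (simp add: graph_integral_def empirical_law_def sum_distrib_left mult_ac)
  also have "\<dots> = (\<Sum>j<n. \<Sum>e\<in>corr_graph A. if (xs ! j, xs ! (j + 1)) = e then \<phi> e else 0)"
    by (subst sum.swap) (simp add: of_bool_def if_distrib cong: if_cong)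
  also have "\<dots> = (\<Sum>j<n. \<phi> (xs ! j, xs ! (j + 1)))"
    using assms(1) by (intro sum.cong) (auto simp: corr_paths_def corr_graph_def)
  finally show ?thesis .
qed

section \<open>The functions lambda and z\<close>

lemma cosh_sq: "(cosh y)\<^sup>2 = (sinh y)\<^sup>2 + 1" for y :: real
  using hyperbolic_pythagoras[of y] by simp

lemma spin_lambda_alt: "spin_lambda y = cosh y + sqrt ((sinh y)\<^sup>2 + 3)"
  by (simp add: spin_lambda_def cosh_sq add_ac)

lemma spin_lambda_sq: "(spin_lambda y)\<^sup>2 = 2 * cosh y * spin_lambda y + 2"
  by (simp add: spin_lambda_def power2_sum algebra_simps power2_eq_square)

lemma spin_lambda_sq_plus_2:
  "(spin_lambda y)\<^sup>2 + 2 = 2 * spin_lambda y * sqrt ((sinh y)\<^sup>2 + 3)"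
  using spin_lambda_sq[of y] by (simp add: spin_lambda_alt algebra_simps power2_eq_square)

lemma spin_lambda_gt: "2 * cosh y < spin_lambda y"
proof -
  have "cosh y = sqrt ((cosh y)\<^sup>2)"
    by (simp add: cosh_real_nonneg)
  also have "\<dots> < sqrt ((cosh y)\<^sup>2 + 2)"
    by (rule real_sqrt_less_mono) simp
  finally show ?thesis
    by (simp add: spin_lambda_def)
qed

lemma spin_lambda_gt_2: "2 < spin_lambda y"
  using spin_lambda_gt[of y] cosh_real_ge_1[of y] by linarith

lemma spin_lambda_minus [simp]: "spin_lambda (- y) = spin_lambda y"
  by (simp add: spin_lambda_def)

lemma spin_lambda_0: "spin_lambda 0 = 1 + sqrt 3"
  by (simp add: spin_lambda_def)

lemma spin_lambda_mono:
  assumes "\<bar>x\<bar> \<le> b"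
  shows "spin_lambda x \<le> spin_lambda b"
proof -
  have "cosh x = cosh \<bar>x\<bar>"
    by (simp add: abs_if)
  also have "\<dots> \<le> cosh b"
    using assms by (intro cosh_real_nonneg_le_iff[THEN iffD2]) auto
  finally have "cosh x \<le> cosh b" .
  moreover have "(cosh x)\<^sup>2 \<le> (cosh b)\<^sup>2"
    using \<open>cosh x \<le> cosh b\<close> cosh_real_ge_1[of x] by (intro power_mono) auto
  ultimately show ?thesis
    unfolding spin_lambda_def by (intro add_mono) auto
qed

lemma sinh_sq_plus_3_pos: "0 < (sinh y)\<^sup>2 + (3::real)"
  by (smt (verit) zero_le_power2)

lemma spin_z_minus [simp]: "spin_z (- y) = - spin_z y"
  by (simp add: spin_z_def)

lemma spin_z_0 [simp]: "spin_z 0 = 0"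
  by (simp add: spin_z_def)

lemma spin_z_pos: "0 < y \<Longrightarrow> 0 < spin_z y"
  using sinh_sq_plus_3_pos[of y] by (simp add: spin_z_def)

lemma spin_z_less_1: "spin_z y < 1"
proof -
  have "sinh y \<le> sqrt ((sinh y)\<^sup>2)"
    by simp
  also have "\<dots> < sqrt ((sinh y)\<^sup>2 + 3)"
    by (rule real_sqrt_less_mono) simp
  finally show ?thesis
    using sinh_sq_plus_3_pos[of y] by (simp add: spin_z_def)
qed

lemma ln_spin_lambda_deriv:
  "((\<lambda>y. ln (spin_lambda y)) has_real_derivative spin_z y) (at y)"
proof -
  let ?R = "sqrt ((sinh y)\<^sup>2 + 3)"
  have R: "0 < ?R"
    using sinh_sq_plus_3_pos[of y] by simp
  have pos: "0 < cosh y + ?R"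
    using spin_lambda_gt_2[of y] by (simp add: spin_lambda_alt)
  have "((\<lambda>y. ln (cosh y + sqrt ((sinh y)\<^sup>2 + 3))) has_real_derivative
      (sinh y + 2 * sinh y * cosh y / (2 * ?R)) / (cosh y + ?R)) (at y)"
    using pos sinh_sq_plus_3_pos[of y]
    by (auto intro!: derivative_eq_intros simp: field_simps)
  moreover have "(sinh y + 2 * sinh y * cosh y / (2 * ?R)) / (cosh y + ?R) = spin_z y"
  proof -
    have "sinh y + 2 * sinh y * cosh y / (2 * ?R) = sinh y / ?R * (cosh y + ?R)"
      using R by (simp add: field_simps)
    then show ?thesis
      using pos by (simp add: spin_z_def)
  qed
  ultimately show ?thesis
    unfolding spin_lambda_alt by simp
qed

lemma spin_z_deriv:
  "(spin_z has_real_derivative 3 * cosh y / (((sinh y)\<^sup>2 + 3) * sqrt ((sinh y)\<^sup>2 + 3))) (at y)"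
proof -
  let ?q = "(sinh y)\<^sup>2 + 3"
  have q: "0 < ?q" by (rule sinh_sq_plus_3_pos)
  have "((\<lambda>y. sinh y / sqrt ((sinh y)\<^sup>2 + 3)) has_real_derivative
      (cosh y * sqrt ?q - sinh y * (2 * sinh y * cosh y / (2 * sqrt ?q))) /
        (sqrt ?q * sqrt ?q)) (at y)"
    using q by (auto intro!: derivative_eq_intros simp: field_simps)
  moreover have "(cosh y * sqrt ?q - sinh y * (2 * sinh y * cosh y / (2 * sqrt ?q))) /
        (sqrt ?q * sqrt ?q) = 3 * cosh y / (?q * sqrt ?q)"
  proof -
    have "cosh y * sqrt ?q - sinh y * (2 * sinh y * cosh y / (2 * sqrt ?q)) =
        cosh y * (sqrt ?q * sqrt ?q - (sinh y)\<^sup>2) / sqrt ?q"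
      using q by (simp add: field_simps power2_eq_square)
    also have "\<dots> = 3 * cosh y / sqrt ?q"
      using q by simp
    finally show ?thesis
      using q by simp
  qed
  ultimately show ?thesis
    unfolding spin_z_def[abs_def] by simp
qed

lemma sinh_gt_self:
  fixes y :: real
  assumes "0 < y"
  shows "y < sinh y"
proof -
  have "sinh 0 - 0 < sinh y - y"
  proof (rule DERIV_pos_imp_increasing_open[OF assms])
    show "\<exists>d. ((\<lambda>y. sinh y - y) has_real_derivative d) (at x) \<and> 0 < d" if "0 < x" for x :: real
      using that cosh_real_nonneg_less_iff[of 0 x]
      by (intro exI[of _ "cosh x - 1"]) (auto intro!: derivative_eq_intros)
  qed (auto intro!: continuous_intros)
  then show ?thesis by simp
qed

text \<open>
  Up to the positive factor \<open>((sinh y)\<^sup>2 + 3) * sqrt ((sinh y)\<^sup>2 + 3)\<close> this says that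
  \<open>y * z' y < z y\<close>, so that the ratio \<open>z y / y\<close> decreases.
\<close>

lemma spin_z_slope_less:
  fixes y :: real
  assumes "0 < y"
  shows "3 * y * cosh y < sinh y * ((sinh y)\<^sup>2 + 3)"
proof -
  let ?f = "\<lambda>y :: real. sinh y * ((sinh y)\<^sup>2 + 3) - 3 * y * cosh y"
  have "?f 0 < ?f y"
  proof (rule DERIV_pos_imp_increasing_open[OF assms])
    fix x :: real assume x: "0 < x"
    have "sinh x * 1 \<le> sinh x * cosh x"
      using x cosh_real_ge_1[of x] by (intro mult_left_mono) auto
    then have "x < sinh x * cosh x"
      using sinh_gt_self[OF x] by simp
    then have "0 < 3 * sinh x * (sinh x * cosh x - x)"
      using x by simp
    moreover have "(?f has_real_derivative 3 * sinh x * (sinh x * cosh x - x)) (at x)"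
      by (auto intro!: derivative_eq_intros simp: power2_eq_square algebra_simps)
    ultimately show "\<exists>d. (?f has_real_derivative d) (at x) \<and> 0 < d"
      by blast
  qed (auto intro!: continuous_intros)
  then show ?thesis by simp
qed

lemma spin_z_ratio_decreasing:
  assumes "0 < a" "a < b"
  shows "spin_z b / b < spin_z a / a"
proof (rule DERIV_neg_imp_decreasing[OF assms(2)])
  fix y assume "a \<le> y"
  then have y: "0 < y" using assms by simp
  let ?q = "(sinh y)\<^sup>2 + 3"
  let ?d = "3 * cosh y / (?q * sqrt ?q)"
  have q: "0 < ?q" by (rule sinh_sq_plus_3_pos)
  have "((\<lambda>y. spin_z y / y) has_real_derivative (?d * y - spin_z y) / (y * y)) (at y)"
    using y by (auto intro!: derivative_eq_intros spin_z_deriv)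
  moreover have "?d * y - spin_z y = (3 * y * cosh y - sinh y * ?q) / (?q * sqrt ?q)"
    using q by (simp add: spin_z_def diff_divide_distrib mult_ac)
  then have "?d * y - spin_z y < 0"
    using spin_z_slope_less[OF y] q by (simp add: divide_neg_pos)
  ultimately show "\<exists>d. ((\<lambda>y. spin_z y / y) has_real_derivative d) (at y) \<and> d < 0"
    using y by (meson divide_neg_pos mult_pos_pos)
qed

text \<open>This form keeps the irrational factor out of the asymptotic expansions at \<open>0\<close>.\<close>

lemma sqrt3_spin_z: "sqrt 3 * spin_z y = sinh y / sqrt (1 + (sinh y)\<^sup>2 / 3)"
proof -
  have "sqrt ((sinh y)\<^sup>2 + 3) = sqrt 3 * sqrt (1 + (sinh y)\<^sup>2 / 3)"
    by (simp flip: real_sqrt_mult add: algebra_simps)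
  then show ?thesis
    by (simp add: spin_z_def)
qed

lemma spin_z_ratio_expansion:
  "((\<lambda>y. (1 - sqrt 3 * spin_z y / y) / y ^ 4) \<longlongrightarrow> 1 / 30) (at_right 0)"
  unfolding sqrt3_spin_z by real_asymp

lemma spin_z_ratio_limit: "((\<lambda>y. spin_z y / y) \<longlongrightarrow> 1 / sqrt 3) (at_right 0)"
proof -
  have "((\<lambda>y. sqrt 3 * spin_z y / y / sqrt 3) \<longlongrightarrow> 1 / sqrt 3) (at_right 0)"
    unfolding sqrt3_spin_z by (intro tendsto_divide tendsto_const) (real_asymp | simp)+
  then show ?thesis by simp
qed

lemma spin_z_ratio_less:
  assumes "0 < y"
  shows "spin_z y / y < 1 / sqrt 3"
proof -
  \<comment> \<open>The intermediate point \<open>y / 2\<close> makes the inequality with the limit at \<open>0\<close> strict.\<close>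
  have "spin_z y / y < spin_z (y / 2) / (y / 2)"
    using assms by (intro spin_z_ratio_decreasing) auto
  also have "\<dots> \<le> 1 / sqrt 3"
  proof (rule tendsto_lowerbound[OF spin_z_ratio_limit])
    have "\<forall>\<^sub>F x in at_right 0. x \<in> {0<..<y / 2}"
      using assms by (intro eventually_at_right_real) simp
    then show "\<forall>\<^sub>F x in at_right 0. spin_z (y / 2) / (y / 2) \<le> spin_z x / x"
      by eventually_elim (intro less_imp_le spin_z_ratio_decreasing, auto)
  qed simp
  finally show ?thesis .
qed

section \<open>The self-consistency equation\<close>

lemma pos_if_sqrt3_less: "sqrt 3 < \<beta> \<Longrightarrow> 0 < \<beta>"
  by (rule less_trans[of _ "sqrt 3"]) simp_all

lemma self_consistent_iff: "self_consistent \<beta> y \<longleftrightarrow> 0 < y \<and> y = \<beta> * spin_z y"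
  by (simp add: self_consistent_def spin_z_def)

lemma ex1_self_consistent:
  assumes "sqrt 3 < \<beta>"
  shows "\<exists>!y. self_consistent \<beta> y"
proof (rule ex_ex1I)
  have b: "0 < \<beta>"
    using assms by (rule pos_if_sqrt3_less)
  have "\<forall>\<^sub>F y in at_right 0. 1 / \<beta> < spin_z y / y"
    using assms b by (intro order_tendstoD[OF spin_z_ratio_limit]) (simp add: field_simps)
  moreover have "\<forall>\<^sub>F y in at_right 0. y \<in> {0<..<\<beta>}"
    using b by (rule eventually_at_right_real)
  ultimately have "\<forall>\<^sub>F y in at_right 0. 0 < y \<and> y < \<beta> \<and> y < \<beta> * spin_z y"
    by eventually_elim (use b in \<open>simp add: field_simps\<close>)
  then obtain a where a: "0 < a" "a < \<beta>" "a < \<beta> * spin_z a"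
    using eventually_happens'[OF trivial_limit_at_right_real] by blast
  have "\<exists>y\<ge>a. y \<le> \<beta> \<and> \<beta> * spin_z y - y = 0"
  proof (rule IVT2')
    show "continuous_on {a..\<beta>} (\<lambda>y. \<beta> * spin_z y - y)"
      by (intro continuous_intros continuous_at_imp_continuous_on ballI)
        (rule DERIV_isCont[OF spin_z_deriv])
    show "\<beta> * spin_z \<beta> - \<beta> \<le> 0"
      using spin_z_less_1[of \<beta>] b by simp
  qed (use a in auto)
  then obtain y where "a \<le> y" "\<beta> * spin_z y - y = 0"
    by blast
  then show "\<exists>y. self_consistent \<beta> y"
    using a(1) by (intro exI[of _ y]) (simp add: self_consistent_iff)
next
  fix x y assume xy: "self_consistent \<beta> x" "self_consistent \<beta> y"
  have "\<beta> \<noteq> 0" using xy by (auto simp: self_consistent_iff)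
  then have "spin_z x / x = 1 / \<beta>" "spin_z y / y = 1 / \<beta>" "0 < x" "0 < y"
    using xy by (auto simp: self_consistent_iff field_simps)
  then show "x = y"
    using spin_z_ratio_decreasing[of x y] spin_z_ratio_decreasing[of y x]
    by (metis less_irrefl linorder_neqE_linordered_idom)
qed

text \<open>
  The nonnegative solution of \<open>y = \<beta> * spin_z y\<close> selected by the maximization: \<open>0\<close> up to the critical
  value, and the positive solution beyond it.
\<close>

definition spin_branch :: "real \<Rightarrow> real" where
  "spin_branch \<beta> = (if \<beta> \<le> sqrt 3 then 0 else y_sol \<beta>)"

lemma self_consistent_y_sol: "sqrt 3 < \<beta> \<Longrightarrow> self_consistent \<beta> (y_sol \<beta>)"
  unfolding y_sol_def by (rule theI'[OF ex1_self_consistent])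

lemma spin_branch_fixed: "spin_branch \<beta> = \<beta> * spin_z (spin_branch \<beta>)"
  using self_consistent_y_sol[of \<beta>] by (simp add: spin_branch_def self_consistent_iff)

lemma spin_branch_nonneg: "0 \<le> spin_branch \<beta>"
  using self_consistent_y_sol[of \<beta>] by (auto simp: spin_branch_def self_consistent_iff)

text \<open>
  The position of \<open>y\<close> relative to the branch is expressed by strict inequalities that are affine in
  \<open>\<beta>\<close>.  This yields both the continuity of the branch in \<open>\<beta>\<close> and the maximization of
  \<open>tilted_value\<close>.
\<close>

lemma spin_branch_compare:
  assumes "0 \<le> \<beta>" "0 < y"
  shows "y < spin_branch \<beta> \<longleftrightarrow> y < \<beta> * spin_z y"
    and "spin_branch \<beta> < y \<longleftrightarrow> \<beta> * spin_z y < y"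
proof -
  let ?Y = "spin_branch \<beta>"
  have less: "y < \<beta> * spin_z y" if "y < ?Y"
  proof -
    have Y: "0 < ?Y" using that assms by simp
    then have b: "0 < \<beta>" using spin_branch_fixed[of \<beta>] assms(1)
      by (metis less_eq_real_def less_irrefl mult_zero_left)
    have "1 / \<beta> = spin_z ?Y / ?Y"
      using spin_branch_fixed[of \<beta>] Y b by (simp add: field_simps)
    also have "\<dots> < spin_z y / y"
      using assms(2) that by (rule spin_z_ratio_decreasing)
    finally show ?thesis
      using b assms(2) by (simp add: field_simps)
  qed
  have greater: "\<beta> * spin_z y < y" if "?Y < y"
  proof (cases "\<beta> = 0")
    case False
    then have b: "0 < \<beta>" using assms(1) by simp
    have "spin_z y / y < 1 / \<beta>"
    proof (cases "\<beta> \<le> sqrt 3")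
      case True
      then have "1 / sqrt 3 \<le> 1 / \<beta>"
        using b by (simp add: field_simps)
      then show ?thesis
        using spin_z_ratio_less[OF assms(2)] by simp
    next
      case False
      then have Y: "0 < ?Y"
        using self_consistent_y_sol[of \<beta>] by (simp add: spin_branch_def self_consistent_iff)
      have "spin_z y / y < spin_z ?Y / ?Y"
        using Y that by (rule spin_z_ratio_decreasing)
      also have "\<dots> = 1 / \<beta>"
        using spin_branch_fixed[of \<beta>] Y b by (simp add: field_simps)
      finally show ?thesis .
    qed
    then show ?thesis
      using b assms(2) by (simp add: field_simps)
  qed (use assms in simp)
  have equal: "y = \<beta> * spin_z y" if "y = ?Y"
    using spin_branch_fixed[of \<beta>] that by simp
  show "y < ?Y \<longleftrightarrow> y < \<beta> * spin_z y"
    using less greater equal by (cases y ?Y rule: linorder_cases) auto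
  show "?Y < y \<longleftrightarrow> \<beta> * spin_z y < y"
    using less greater equal by (cases y ?Y rule: linorder_cases) auto
qed

lemma continuous_on_spin_branch: "continuous_on {0..} spin_branch"
  unfolding continuous_on_def
proof (intro ballI order_tendstoI)
  fix \<beta> a assume b: "\<beta> \<in> {0::real..}"
  have ev: "\<forall>\<^sub>F b in at \<beta> within {0..}. b \<in> {0..}"
    by (simp add: eventually_at_filter)
  have lim: "((\<lambda>b. b * spin_z a) \<longlongrightarrow> \<beta> * spin_z a) (at \<beta> within {0..})"
    by (intro tendsto_intros)
  show "\<forall>\<^sub>F b in at \<beta> within {0..}. a < spin_branch b" if "a < spin_branch \<beta>"
  proof (cases "a < 0")
    case True
    then show ?thesis
      using spin_branch_nonneg by (simp add: less_le_trans)
  next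
    case False
    obtain c where c: "a < c" "c < spin_branch \<beta>" using dense \<open>a < _\<close> by blast
    then have c0: "0 < c" using False by simp
    have "c < \<beta> * spin_z c"
      using spin_branch_compare(1)[of \<beta> c] b c c0 by simp
    moreover have "((\<lambda>b. b * spin_z c) \<longlongrightarrow> \<beta> * spin_z c) (at \<beta> within {0..})"
      by (intro tendsto_intros)
    ultimately have "\<forall>\<^sub>F b in at \<beta> within {0..}. c < b * spin_z c"
      by (intro order_tendstoD)
    with ev show ?thesis
      by eventually_elim (use c c0 spin_branch_compare(1)[of _ c] in force)
  qed
  show "\<forall>\<^sub>F b in at \<beta> within {0..}. spin_branch b < a" if "spin_branch \<beta> < a"
  proof -
    have a0: "0 < a" using that spin_branch_nonneg[of \<beta>] by simp
    then have "\<beta> * spin_z a < a"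
      using spin_branch_compare(2)[of \<beta> a] b that by simp
    with lim have "\<forall>\<^sub>F b in at \<beta> within {0..}. b * spin_z a < a"
      by (rule order_tendstoD)
    with ev show ?thesis
      by eventually_elim (use a0 spin_branch_compare(2)[of _ a] in force)
  qed
qed

text \<open>
  The bound on the nonlinear value of a stationary pair of correlation \<open>c\<close>, obtained from the linear
  principle with \<open>y = \<beta> * c\<close>.
\<close>

definition tilted_value :: "real \<Rightarrow> real \<Rightarrow> real" where
  "tilted_value \<beta> c = ln (spin_lambda (\<beta> * c)) - \<beta> / 2 * c\<^sup>2"

lemma tilted_value_deriv:
  "(tilted_value \<beta> has_real_derivative \<beta> * (spin_z (\<beta> * c) - c)) (at c)"
proof -
  have "((\<lambda>c. ln (spin_lambda (\<beta> * c))) has_real_derivative spin_z (\<beta> * c) * \<beta>) (at c)"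
    by (rule DERIV_chain2[OF ln_spin_lambda_deriv]) (auto intro!: derivative_eq_intros)
  then show ?thesis
    unfolding tilted_value_def[abs_def]
    by (rule DERIV_cong[OF DERIV_diff]) (auto intro!: derivative_eq_intros simp: algebra_simps)
qed

lemma tilted_value_abs: "tilted_value \<beta> \<bar>c\<bar> = tilted_value \<beta> c"
  by (simp add: tilted_value_def abs_if)

lemma tilted_value_max_strict:
  assumes "0 < \<beta>" "0 \<le> c" "\<beta> * c \<noteq> spin_branch \<beta>"
  shows "tilted_value \<beta> c < tilted_value \<beta> (spin_z (spin_branch \<beta>))"
proof -
  let ?m = "spin_z (spin_branch \<beta>)"
  have m: "\<beta> * ?m = spin_branch \<beta>"
    using spin_branch_fixed by simp
  have cont: "continuous_on {a..b} (tilted_value \<beta>)" for a b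
    by (intro continuous_at_imp_continuous_on ballI DERIV_isCont[OF tilted_value_deriv])
  show ?thesis
  proof (cases "c < ?m")
    case True
    then show ?thesis
    proof (rule DERIV_pos_imp_increasing_open[OF _ _ cont])
      fix x assume x: "c < x" "x < ?m"
      have "\<beta> * x < \<beta> * ?m" "0 < \<beta> * x"
        using x assms by simp_all
      then have "\<beta> * x < spin_branch \<beta>" "0 < \<beta> * x"
        unfolding m by blast+
      then have "0 < \<beta> * (spin_z (\<beta> * x) - x)"
        using spin_branch_compare(1)[of \<beta> "\<beta> * x"] assms by simp
      then show "\<exists>d. (tilted_value \<beta> has_real_derivative d) (at x) \<and> 0 < d"
        using tilted_value_deriv by blast
    qed
  next
    case False
    then have "?m < c"
      using assms(3) m by (metis linorder_neqE_linordered_idom)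
    then show ?thesis
    proof (rule DERIV_neg_imp_decreasing_open[OF _ _ cont])
      fix x assume x: "?m < x" "x < c"
      have "\<beta> * ?m < \<beta> * x"
        using x assms by simp
      then have "spin_branch \<beta> < \<beta> * x"
        unfolding m .
      moreover from this have "0 < \<beta> * x"
        using spin_branch_nonneg[of \<beta>] by simp
      ultimately have "\<beta> * (spin_z (\<beta> * x) - x) < 0"
        using spin_branch_compare(2)[of \<beta> "\<beta> * x"] assms by (simp add: mult_less_0_iff)
      then show "\<exists>d. (tilted_value \<beta> has_real_derivative d) (at x) \<and> d < 0"
        using tilted_value_deriv by blast
    qed
  qed
qed

text \<open>The maximum of \<open>tilted_value\<close>, shown below to be the pressure.\<close>

definition pressure_value :: "real \<Rightarrow> real" where
  "pressure_value \<beta> = tilted_value \<beta> (spin_z (spin_branch \<beta>))"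

text \<open>
  The equality case also covers \<open>\<beta> = 0\<close>, where \<open>tilted_value\<close> is constant and both sides of the
  conclusion vanish.
\<close>

lemma tilted_value_le:
  assumes "0 \<le> \<beta>"
  shows "tilted_value \<beta> c \<le> pressure_value \<beta>"
    and "tilted_value \<beta> c = pressure_value \<beta> \<Longrightarrow> \<bar>\<beta> * c\<bar> = spin_branch \<beta>"
proof -
  have strict: "tilted_value \<beta> c < pressure_value \<beta>" if "\<bar>\<beta> * c\<bar> \<noteq> spin_branch \<beta>"
  proof (cases "\<beta> = 0")
    case True
    then show ?thesis
      using that by (simp add: spin_branch_def)
  next
    case False
    then have "tilted_value \<beta> \<bar>c\<bar> < pressure_value \<beta>"
      unfolding pressure_value_def using assms that
      by (intro tilted_value_max_strict) (auto simp: abs_mult)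
    then show ?thesis by (simp add: tilted_value_abs)
  qed
  have "tilted_value \<beta> c \<le> pressure_value \<beta>" if "\<bar>\<beta> * c\<bar> = spin_branch \<beta>"
  proof (cases "\<beta> = 0")
    case True
    then show ?thesis
      by (simp add: tilted_value_def pressure_value_def)
  next
    case False
    then have "\<bar>c\<bar> = spin_z (spin_branch \<beta>)"
      using that spin_branch_fixed[of \<beta>] assms
      by (metis abs_mult abs_of_nonneg mult_cancel_left)
    then show ?thesis
      using tilted_value_abs[of \<beta> c] by (simp add: pressure_value_def)
  qed
  with strict show "tilted_value \<beta> c \<le> pressure_value \<beta>"
    by fastforce
  show "\<bar>\<beta> * c\<bar> = spin_branch \<beta>" if "tilted_value \<beta> c = pressure_value \<beta>"
    using strict that by fastforce
qed

lemma pressure_value_eq: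
  "pressure_value \<beta> = (if \<beta> \<le> sqrt 3 then ln (1 + sqrt 3)
     else ln (spin_lambda (y_sol \<beta>)) - \<beta> / 2 * (spin_z (y_sol \<beta>))\<^sup>2)"
  using spin_branch_fixed[of \<beta>]
  by (simp add: pressure_value_def tilted_value_def spin_branch_def spin_lambda_0 split: if_splits)

section \<open>The Markov chains of the three-state model\<close>

lemma sum_spin: "(\<Sum>i\<in>UNIV. f i) = f Minus + f Zero + f Plus" for f :: "spin \<Rightarrow> 'b::comm_monoid_add"
  by (simp add: UNIV_spin add_ac)

lemma correspondence_spin_adj:
  "correspondence spin_adj Minus = {Minus, Zero, Plus}"
  "correspondence spin_adj Zero = {Minus, Plus}"
  "correspondence spin_adj Plus = {Minus, Zero, Plus}"
  by (auto simp: correspondence_def spin_adj_def split: spin.splits intro: spin.exhaust)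

text \<open>The right eigenvector for the potential \<open>y * spin_product e\<close>.\<close>

definition spin_right :: "real \<Rightarrow> spin \<Rightarrow> real" where
  "spin_right y = case_spin 1 (2 / spin_lambda y) 1"

lemma exp_plus_exp_minus: "exp (- y) + exp y = 2 * cosh y" for y :: real
  by (simp add: cosh_def)

lemma spin_lambda_eq: "spin_lambda y = 2 * cosh y + 2 / spin_lambda y"
proof -
  have "spin_lambda y \<noteq> 0"
    using spin_lambda_gt_2[of y] by simp
  then have "spin_lambda y = (spin_lambda y)\<^sup>2 / spin_lambda y"
    by (simp add: power2_eq_square)
  also have "\<dots> = 2 * cosh y + 2 / spin_lambda y"
    using \<open>spin_lambda y \<noteq> 0\<close> by (simp add: spin_lambda_sq add_divide_distrib)
  finally show ?thesis .
qed

lemma transfer_eigen_spin: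
  "transfer_eigen spin_adj (\<lambda>e. y * spin_product e) (spin_right y) (spin_lambda y)"
proof -
  have l: "0 < spin_lambda y"
    using spin_lambda_gt_2[of y] by simp
  have "exp (- y) + 2 / spin_lambda y + exp y = spin_lambda y"
    using spin_lambda_eq[of y] exp_plus_exp_minus[of y] by linarith
  then have "(\<Sum>j\<in>correspondence spin_adj i. exp (y * spin_product (i, j)) * spin_right y j) =
      spin_lambda y * spin_right y i" for i
    using l by (cases i)
      (simp_all add: correspondence_spin_adj spin_right_def spin_product_def spin_value_def)
  moreover have "0 < spin_right y i" for i
    using l by (cases i) (simp_all add: spin_right_def)
  ultimately show ?thesis
    using l by (simp add: transfer_eigen_def)
qed

lemma doob_kernel_spin:
  "doob_kernel spin_adj (\<lambda>e. y * spin_product e) (spin_right y) (spin_lambda y) =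
     spin_kernel y"
proof (intro ext)
  fix i j
  have "0 < spin_lambda y"
    using spin_lambda_gt_2[of y] by simp
  then show "doob_kernel spin_adj (\<lambda>e. y * spin_product e) (spin_right y) (spin_lambda y) i j =
      spin_kernel y i j"
    by (cases i; cases j)
      (simp_all add: doob_kernel_def correspondence_spin_adj spin_right_def spin_product_def
        spin_value_def spin_kernel_def power2_eq_square)
qed

lemma spin_kernel_return:
  "exp y / spin_lambda y + exp (- y) / spin_lambda y = 1 - 2 / (spin_lambda y)\<^sup>2"
proof -
  have l: "spin_lambda y \<noteq> 0"
    using spin_lambda_gt_2[of y] by simp
  have "exp y / spin_lambda y + exp (- y) / spin_lambda y =
      (spin_lambda y - 2 / spin_lambda y) / spin_lambda y"
    using spin_lambda_eq[of y] exp_plus_exp_minus[of y]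
    by (simp add: add.commute flip: add_divide_distrib)
  also have "\<dots> = 1 - 2 / (spin_lambda y)\<^sup>2"
    using l by (simp add: diff_divide_distrib power2_eq_square)
  finally show ?thesis .
qed

lemma stationary_spin_pair: "stationary_pair spin_adj (spin_pair y)"
proof -
  have l: "0 < spin_lambda y"
    using spin_lambda_gt_2[of y] by simp
  let ?L = "(spin_lambda y)\<^sup>2"
  have L: "0 < ?L"
    using l by simp
  let ?m = "?L / (2 * (?L + 2))" and ?z = "2 / (?L + 2)"
  have z: "?z = ?m * (2 / ?L) + ?m * (2 / ?L)"
  proof -
    \<comment> \<open>The denominator is made opaque so that simplification does not multiply it out.\<close>
    obtain D where D: "?L + 2 = D" by blast
    show ?thesis
      unfolding D using L by simp
  qed
  have e: "?m * (exp y / spin_lambda y) + ?m * (exp (- y) / spin_lambda y) =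
      ?m - ?m * (2 / ?L)"
    unfolding distrib_left[symmetric] spin_kernel_return
    by (simp only: right_diff_distrib mult_1_right)
  \<comment> \<open>The balance equations are linear in the products once these are replaced by variables.\<close>
  have lin: "m * p + z * (1 / 2) + m * q = m" "m * q + z * (1 / 2) + m * p = m"
      "m * w + z * 0 + m * w = z"
    if "m * p + m * q = m - m * w" "z = m * w + m * w" for m p q z w :: real
    using that by linarith+
  have m: "0 \<le> spin_measure y i" for i
    by (cases i) (simp_all add: spin_measure_def)
  have s: "(\<Sum>i\<in>UNIV. spin_measure y i) = 1"
  proof -
    have "?L / (2 * D) + 2 / D + ?L / (2 * D) = (?L + 2) / D" for D
      by (simp add: add_divide_distrib)
    from this[of "?L + 2"] have "?m + ?z + ?m = 1"
      using L by simp
    then show ?thesis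
      by (simp only: sum_spin spin_measure_def spin.case)
  qed
  have K: "prob_vector (spin_kernel y i)" for i
    using prob_vector_doob_kernel[OF transfer_eigen_spin[of y], of i]
    by (simp add: doob_kernel_spin)
  have f: "spin_kernel y i j = 0" if "spin_adj i j = 0" for i j
    using that by (cases i; cases j) (simp_all add: spin_adj_def spin_kernel_def)
  have "(\<Sum>i\<in>UNIV. spin_measure y i * spin_kernel y i j) = spin_measure y j" for j
  proof (cases j)
    case Minus
    have "?m * (exp y / spin_lambda y) + ?z * (1 / 2) + ?m * (exp (- y) / spin_lambda y) = ?m"
      by (rule lin(1)[OF e z])
    then show ?thesis
      by (simp only: Minus sum_spin spin_measure_def spin_kernel_def spin.case)
  next
    case Zero
    have "?m * (2 / ?L) + ?z * 0 + ?m * (2 / ?L) = ?z"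
      by (rule lin(3)[OF e z])
    then show ?thesis
      by (simp only: Zero sum_spin spin_measure_def spin_kernel_def spin.case)
  next
    case Plus
    have "?m * (exp (- y) / spin_lambda y) + ?z * (1 / 2) + ?m * (exp y / spin_lambda y) = ?m"
      by (rule lin(2)[OF e z])
    then show ?thesis
      by (simp only: Plus sum_spin spin_measure_def spin_kernel_def spin.case)
  qed
  with m s K f show ?thesis
    by (simp add: stationary_pair_def spin_pair_def prob_vector_def[of "spin_measure y"])
qed

text \<open>
  By the equations at \<open>-1\<close> and \<open>+1\<close>, the asymmetry \<open>\<mu> Plus - \<mu> Minus\<close> is annihilated by
  \<open>spin_lambda y - 2 * sinh y > 0\<close>; the equation at \<open>0\<close> then fixes \<open>\<mu> Zero\<close>.
\<close>

lemma spin_invariant_measure_unique: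
  assumes "prob_vector \<mu>" and inv: "\<And>j. (\<Sum>i\<in>UNIV. \<mu> i * spin_kernel y i j) = \<mu> j"
  shows "\<mu> = spin_measure y"
proof -
  let ?l = "spin_lambda y"
  have l: "0 < ?l" using spin_lambda_gt_2[of y] by simp
  have s: "\<mu> Minus + \<mu> Zero + \<mu> Plus = 1"
    using assms(1) by (simp add: prob_vector_def sum_spin)
  have z: "\<mu> Minus * (2 / ?l\<^sup>2) + \<mu> Plus * (2 / ?l\<^sup>2) = \<mu> Zero"
    using inv[of Zero] by (simp add: sum_spin spin_kernel_def)
  have m: "\<mu> Minus * (exp y / ?l) + \<mu> Zero / 2 + \<mu> Plus * (exp (- y) / ?l) = \<mu> Minus"
    using inv[of Minus] by (simp add: sum_spin spin_kernel_def)
  have p: "\<mu> Minus * (exp (- y) / ?l) + \<mu> Zero / 2 + \<mu> Plus * (exp y / ?l) = \<mu> Plus"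
    using inv[of Plus] by (simp add: sum_spin spin_kernel_def)
  have "(\<mu> Plus - \<mu> Minus) * (?l - (exp y - exp (- y))) = 0"
    using m p l by (simp add: field_simps)
  moreover have "exp y - exp (- y) < ?l"
    using spin_lambda_gt[of y] exp_plus_exp_minus[of y] exp_gt_zero[of "- y"] by linarith
  ultimately have eq: "\<mu> Plus = \<mu> Minus" by simp
  have "2 * \<mu> Minus + \<mu> Zero = 1" "4 * \<mu> Minus = \<mu> Zero * ?l\<^sup>2"
    using s z eq l by (simp_all add: field_simps)
  then have Z: "\<mu> Zero * (?l\<^sup>2 + 2) = 2"
    by (simp add: algebra_simps)
  moreover have nz: "?l\<^sup>2 + 2 \<noteq> 0"
    using zero_le_power2[of ?l] by linarith
  ultimately have "\<mu> Zero = 2 / (?l\<^sup>2 + 2)"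
    by (simp add: nonzero_eq_divide_eq)
  moreover have "\<mu> Minus = ?l\<^sup>2 / (2 * (?l\<^sup>2 + 2))"
  proof -
    have "2 * \<mu> Minus = (?l\<^sup>2 + 2) / (?l\<^sup>2 + 2) - 2 / (?l\<^sup>2 + 2)"
      using \<open>2 * \<mu> Minus + \<mu> Zero = 1\<close> nz calculation by simp
    also have "\<dots> = ?l\<^sup>2 / (?l\<^sup>2 + 2)"
      unfolding diff_divide_distrib[symmetric] by simp
    finally have h: "2 * \<mu> Minus = ?l\<^sup>2 / (?l\<^sup>2 + 2)" .
    have "\<mu> Minus = (2 * \<mu> Minus) / 2"
      by simp
    also have "\<dots> = ?l\<^sup>2 / (2 * (?l\<^sup>2 + 2))"
      unfolding h by (simp only: divide_divide_eq_left mult.commute)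
    finally show ?thesis .
  qed
  ultimately show ?thesis
    using eq by (intro ext) (simp add: spin_measure_def split: spin.split)
qed

lemma correlation_eq:
  assumes "stationary_pair spin_adj (\<mu>, Q)"
  shows "correlation (\<mu>, Q) = \<mu> Minus * (Q Minus Minus - Q Minus Plus) +
     \<mu> Plus * (Q Plus Plus - Q Plus Minus)"
  unfolding correlation_def graph_integral_law[OF zero_one_spin_adj assms]
  by (simp add: sum_spin spin_product_def spin_value_def algebra_simps)

lemma correlation_spin_pair: "correlation (spin_pair y) = spin_z y"
proof -
  let ?l = "spin_lambda y" and ?R = "sqrt ((sinh y)\<^sup>2 + 3)"
  have l: "0 < ?l" and R: "0 < ?R"
    using spin_lambda_gt_2[of y] sinh_sq_plus_3_pos[of y] by simp_all
  have "exp y - exp (- y) = 2 * sinh y"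
    by (simp add: sinh_def)
  then have d: "exp y / ?l - exp (- y) / ?l = 2 * sinh y / ?l"
    by (simp flip: diff_divide_distrib)
  have "correlation (spin_pair y) = 2 * (?l\<^sup>2 / (2 * (?l\<^sup>2 + 2)) * (2 * sinh y / ?l))"
    using correlation_eq[of "spin_measure y" "spin_kernel y"] stationary_spin_pair[of y]
    by (simp add: spin_pair_def spin_measure_def spin_kernel_def d mult_ac)
  also have "\<dots> = spin_z y"
    using l R unfolding spin_lambda_sq_plus_2 by (simp add: spin_z_def power2_eq_square)
  finally show ?thesis .
qed

lemma graph_integral_scale:
  "graph_integral A (\<lambda>e. y * f e) g = y * graph_integral A f g"
  by (simp add: graph_integral_def sum_distrib_left mult_ac)

lemma spin_linear_free_energy:
  assumes "stationary_pair spin_adj q"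
  shows "entropy_rate q + y * correlation q \<le> ln (spin_lambda y)"
    and "entropy_rate q + y * correlation q = ln (spin_lambda y) \<longleftrightarrow> same_pair q (spin_pair y)"
proof -
  obtain \<mu> Q where q: "q = (\<mu>, Q)" by fastforce
  have st: "stationary_pair spin_adj (\<mu>, Q)"
    using assms by (simp add: q)
  note F = linear_free_energy[OF zero_one_spin_adj st transfer_eigen_spin[of y],
      unfolded graph_integral_scale doob_kernel_spin]
  show "entropy_rate q + y * correlation q \<le> ln (spin_lambda y)"
    using F(1) by (simp add: q correlation_def)
  have "\<mu> = spin_measure y" if k: "\<forall>i. \<mu> i \<noteq> 0 \<longrightarrow> Q i = spin_kernel y i"
  proof (rule spin_invariant_measure_unique)
    show "prob_vector \<mu>"
      using st by (simp add: stationary_pair_def)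
    fix j
    have "\<mu> i * spin_kernel y i j = \<mu> i * Q i j" for i
      using k by (cases "\<mu> i = 0") simp_all
    then have "(\<Sum>i\<in>UNIV. \<mu> i * spin_kernel y i j) = (\<Sum>i\<in>UNIV. \<mu> i * Q i j)"
      by presburger
    then show "(\<Sum>i\<in>UNIV. \<mu> i * spin_kernel y i j) = \<mu> j"
      using st by (simp add: stationary_pair_def)
  qed
  then show "entropy_rate q + y * correlation q = ln (spin_lambda y) \<longleftrightarrow> same_pair q (spin_pair y)"
    using F(2) by (auto simp: q correlation_def same_pair_def spin_pair_def)
qed

lemma same_pair_refl: "same_pair p p"
  by (simp add: same_pair_def split_def)

lemma same_pair_law: "same_pair p q \<Longrightarrow> two_coordinate_law p = two_coordinate_law q"
  by (force simp: same_pair_def two_coordinate_law_def split_def)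

lemma entropy_spin_pair: "entropy_rate (spin_pair y) = ln (spin_lambda y) - y * spin_z y"
  using spin_linear_free_energy(2)[OF stationary_spin_pair[of y], of y]
  by (simp add: same_pair_refl correlation_spin_pair)

lemma only_linear_equilibrium_spin_pair:
  "only_pair (linear_equilibrium_pair spin_adj (\<lambda>e. y * spin_product e)) (spin_pair y)"
proof -
  have v: "entropy_rate q + graph_integral spin_adj (\<lambda>e. y * spin_product e) (two_coordinate_law q) =
      entropy_rate q + y * correlation q" for q
    by (simp add: graph_integral_scale correlation_def)
  have top: "entropy_rate (spin_pair y) + y * correlation (spin_pair y) = ln (spin_lambda y)"
    by (simp add: entropy_spin_pair correlation_spin_pair)
  show ?thesis
    unfolding only_pair_def linear_equilibrium_pair_def equilibrium_pair_def v top
    using spin_linear_free_energy stationary_spin_pair top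
    by (metis (no_types, lifting) order_antisym)
qed

section \<open>Nonlinear equilibrium pairs\<close>

lemma nonlinear_value_le:
  assumes "0 \<le> \<beta>" "stationary_pair spin_adj q"
  shows "entropy_rate q + spin_energy \<beta> (two_coordinate_law q) \<le> pressure_value \<beta>"
    and "entropy_rate q + spin_energy \<beta> (two_coordinate_law q) = pressure_value \<beta> \<Longrightarrow>
      \<exists>y. \<bar>y\<bar> = spin_branch \<beta> \<and> same_pair q (spin_pair y)"
proof -
  let ?c = "correlation q"
  have e: "entropy_rate q + spin_energy \<beta> (two_coordinate_law q) =
      entropy_rate q + (\<beta> * ?c) * ?c - \<beta> / 2 * ?c\<^sup>2"
    by (simp add: spin_energy_def correlation_def power2_eq_square)
  have lin: "entropy_rate q + (\<beta> * ?c) * ?c \<le> ln (spin_lambda (\<beta> * ?c))"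
    using assms(2) by (rule spin_linear_free_energy)
  show "entropy_rate q + spin_energy \<beta> (two_coordinate_law q) \<le> pressure_value \<beta>"
    using tilted_value_le(1)[OF assms(1), of ?c] lin unfolding e tilted_value_def by linarith
  assume "entropy_rate q + spin_energy \<beta> (two_coordinate_law q) = pressure_value \<beta>"
  then have "entropy_rate q + (\<beta> * ?c) * ?c = ln (spin_lambda (\<beta> * ?c))"
    "tilted_value \<beta> ?c = pressure_value \<beta>"
    using tilted_value_le(1)[OF assms(1), of ?c] lin unfolding e tilted_value_def by linarith+
  then show "\<exists>y. \<bar>y\<bar> = spin_branch \<beta> \<and> same_pair q (spin_pair y)"
    using tilted_value_le(2)[OF assms(1)] spin_linear_free_energy(2)[OF assms(2)] by blast
qed

lemma nonlinear_value_spin_pair: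
  assumes "\<bar>y\<bar> = spin_branch \<beta>"
  shows "entropy_rate (spin_pair y) + spin_energy \<beta> (two_coordinate_law (spin_pair y)) =
    pressure_value \<beta>"
proof -
  have y: "y = spin_branch \<beta> \<or> y = - spin_branch \<beta>"
    using assms by auto
  then have f: "\<beta> * spin_z y = y"
    using spin_branch_fixed[of \<beta>] by auto
  have "spin_energy \<beta> (two_coordinate_law (spin_pair y)) = \<beta> * spin_z y * spin_z y / 2"
    using correlation_spin_pair[of y]
    by (simp add: spin_energy_def correlation_def power2_eq_square)
  then have "entropy_rate (spin_pair y) + spin_energy \<beta> (two_coordinate_law (spin_pair y)) =
      tilted_value \<beta> (spin_z y)"
    by (simp add: entropy_spin_pair tilted_value_def f power2_eq_square flip: mult.assoc)
  also have "\<dots> = pressure_value \<beta>"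
    using y tilted_value_abs[of \<beta> "spin_z y"] tilted_value_abs[of \<beta> "- spin_z y"]
    by (auto simp: pressure_value_def)
  finally show ?thesis .
qed

lemma spin_equilibrium:
  assumes "0 \<le> \<beta>"
  shows "\<bar>y\<bar> = spin_branch \<beta> \<Longrightarrow> equilibrium_pair spin_adj (spin_energy \<beta>) (spin_pair y)"
    and "equilibrium_pair spin_adj (spin_energy \<beta>) q \<Longrightarrow>
      \<exists>y. \<bar>y\<bar> = spin_branch \<beta> \<and> same_pair q (spin_pair y)"
proof -
  show "equilibrium_pair spin_adj (spin_energy \<beta>) (spin_pair y)" if "\<bar>y\<bar> = spin_branch \<beta>"
    unfolding equilibrium_pair_def nonlinear_value_spin_pair[OF that]
    using stationary_spin_pair nonlinear_value_le(1)[OF assms] by blast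
  assume q: "equilibrium_pair spin_adj (spin_energy \<beta>) q"
  have "\<bar>spin_branch \<beta>\<bar> = spin_branch \<beta>"
    by (simp add: spin_branch_nonneg)
  from nonlinear_value_spin_pair[OF this] q
  have "pressure_value \<beta> \<le> entropy_rate q + spin_energy \<beta> (two_coordinate_law q)"
    unfolding equilibrium_pair_def using stationary_spin_pair by metis
  moreover have st: "stationary_pair spin_adj q"
    using q by (simp add: equilibrium_pair_def)
  ultimately show "\<exists>y. \<bar>y\<bar> = spin_branch \<beta> \<and> same_pair q (spin_pair y)"
    using nonlinear_value_le[OF assms st] by simp
qed

lemma unique_equilibrium:
  assumes "0 \<le> \<beta>" "\<beta> \<le> sqrt 3"
  shows "only_pair (equilibrium_pair spin_adj (spin_energy \<beta>)) (spin_pair 0)"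
  using spin_equilibrium[OF assms(1)] assms(2)
  by (auto simp: only_pair_def spin_branch_def)

lemma spin_pair_laws_differ:
  assumes "0 < y"
  shows "two_coordinate_law (spin_pair y) \<noteq> two_coordinate_law (spin_pair (- y))"
proof
  assume "two_coordinate_law (spin_pair y) = two_coordinate_law (spin_pair (- y))"
  then have "correlation (spin_pair y) = correlation (spin_pair (- y))"
    by (simp add: correlation_def)
  then show False
    using spin_z_pos[OF assms] by (simp add: correlation_spin_pair)
qed

lemma two_equilibria:
  assumes "sqrt 3 < \<beta>"
  shows "only_two_pairs (equilibrium_pair spin_adj (spin_energy \<beta>))
    (spin_pair (y_sol \<beta>)) (spin_pair (- y_sol \<beta>))"
proof -
  have b: "0 \<le> \<beta>"
    using pos_if_sqrt3_less[OF assms] by simp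
  have y: "0 < y_sol \<beta>" "spin_branch \<beta> = y_sol \<beta>"
    using self_consistent_y_sol[OF assms] assms by (auto simp: self_consistent_iff spin_branch_def)
  have "\<not> same_pair (spin_pair (y_sol \<beta>)) (spin_pair (- y_sol \<beta>))"
    using same_pair_law spin_pair_laws_differ[OF y(1)] by blast
  moreover have "same_pair q (spin_pair (y_sol \<beta>)) \<or> same_pair q (spin_pair (- y_sol \<beta>))"
    if "equilibrium_pair spin_adj (spin_energy \<beta>) q" for q
    using spin_equilibrium(2)[OF b that] y by (metis abs_if minus_equation_iff)
  ultimately show ?thesis
    using spin_equilibrium(1)[OF b, of "y_sol \<beta>"] spin_equilibrium(1)[OF b, of "- y_sol \<beta>"] y
    by (simp add: only_two_pairs_def)
qed

lemma several_pairs_if_only_two: "only_two_pairs P p q \<Longrightarrow> several_pairs P"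
  unfolding only_two_pairs_def several_pairs_def by blast

lemma same_pair_common: "same_pair p r \<Longrightarrow> same_pair q r \<Longrightarrow> same_pair p q"
  by (simp add: same_pair_def split_def)

lemma not_several_if_only_pair: "only_pair P p \<Longrightarrow> \<not> several_pairs P"
  unfolding only_pair_def several_pairs_def using same_pair_common by blast

lemma spin_measure_minus: "spin_measure (- y) = spin_measure y"
  by (simp add: spin_measure_def)

lemma critical_inverse_temperature_spin:
  "critical_inverse_temperature spin_adj spin_energy b \<longleftrightarrow> b = sqrt 3"
proof
  assume "b = sqrt 3"
  then show "critical_inverse_temperature spin_adj spin_energy b"
    unfolding critical_inverse_temperature_def
    using unique_equilibrium two_equilibria several_pairs_if_only_two
    by (metis less_imp_le real_sqrt_ge_zero zero_le_numeral)
next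
  assume b: "critical_inverse_temperature spin_adj spin_energy b"
  then have b0: "0 \<le> b" by (simp add: critical_inverse_temperature_def)
  show "b = sqrt 3"
  proof (cases b "sqrt 3" rule: linorder_cases)
    case less
    then obtain \<beta> where "b < \<beta>" "\<beta> < sqrt 3" using dense by blast
    then show ?thesis
      using b b0 unique_equilibrium[of \<beta>] not_several_if_only_pair
      unfolding critical_inverse_temperature_def by (meson less_imp_le order_trans)
  next
    case greater
    then obtain \<beta> where \<beta>: "sqrt 3 < \<beta>" "\<beta> < b" using dense by blast
    then have "0 \<le> \<beta>" using pos_if_sqrt3_less[of \<beta>] by simp
    then show ?thesis
      using b \<beta> two_equilibria[of \<beta>] several_pairs_if_only_two not_several_if_only_pair
      unfolding critical_inverse_temperature_def by blast
  qed simp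
qed

section \<open>The nonlinear pressure as a limit\<close>

text \<open>
  The entries of the eigenvector lie between \<open>2 / spin_lambda y\<close> and \<open>1\<close>, so the unweighted path sum
  is comparable to the weighted one.
\<close>

lemma spin_path_sum_bounds:
  fixes y :: real and n :: nat
  defines "S \<equiv> \<Sum>xs\<in>corr_paths spin_adj n. exp (y * (\<Sum>j<n. spin_product (xs ! j, xs ! (j + 1))))"
  shows "spin_lambda y ^ n \<le> S" "S \<le> (spin_lambda y + 1) * spin_lambda y ^ n"
proof -
  let ?l = "spin_lambda y"
  let ?w = "\<lambda>xs. exp (y * (\<Sum>j<n. spin_product (xs ! j, xs ! (j + 1))))"
  have l: "2 < ?l" by (rule spin_lambda_gt_2)
  have r: "2 / ?l \<le> spin_right y i" "spin_right y i \<le> 1" for i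
    using l by (cases i; simp add: spin_right_def)+
  have s: "(\<Sum>xs\<in>corr_paths spin_adj n. ?w xs * spin_right y (xs ! n)) = ?l ^ n * (2 + 2 / ?l)"
    using weighted_path_sum[OF transfer_eigen_spin[of y], of n]
    by (simp add: sum_spin spin_right_def add_ac flip: sum_distrib_left)
  have "?l ^ n * 1 \<le> ?l ^ n * (2 + 2 / ?l)"
    using l by (intro mult_left_mono) (auto simp: add_increasing2)
  also have "\<dots> \<le> S"
    unfolding s[symmetric] S_def using r(2) by (intro sum_mono) (simp add: mult_left_le)
  finally show "?l ^ n \<le> S" by simp
  have "2 / ?l * S \<le> ?l ^ n * (2 + 2 / ?l)"
    unfolding s[symmetric] S_def sum_distrib_left mult.commute[of "2 / ?l"]
    by (intro sum_mono mult_left_mono r(1)) simp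
  also have "\<dots> = 2 / ?l * ((?l + 1) * ?l ^ n)"
    using l by (simp add: field_simps)
  finally show "S \<le> (?l + 1) * ?l ^ n"
    using l by (simp only: mult_le_cancel_left_pos divide_pos_pos zero_less_numeral)
qed

lemma spin_product_int: "spin_product e \<in> \<int>" "\<bar>spin_product e\<bar> \<le> 1"
  by (cases e; auto simp: spin_product_def spin_value_def split: spin.splits)+

text \<open>Hence the empirical correlation takes at most \<open>2 * n + 1\<close> values.\<close>

lemma spin_product_sum_int:
  obtains k where "k \<in> {- int n..int n}"
    "(\<Sum>j<n. spin_product (xs ! j, xs ! (j + 1))) = of_int k"
proof -
  let ?s = "\<Sum>j<n. spin_product (xs ! j, xs ! (j + 1))"
  have "?s \<in> \<int>"
    by (intro Ints_sum spin_product_int)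
  then obtain k where k: "?s = of_int k"
    by (rule Ints_cases)
  have "\<bar>?s\<bar> \<le> (\<Sum>j<n. 1)"
    by (intro order_trans[OF sum_abs] sum_mono spin_product_int)
  then have "k \<in> {- int n..int n}"
    unfolding k by (simp add: abs_le_iff)
  then show ?thesis using k that by blast
qed

lemma spin_energy_empirical:
  assumes "xs \<in> corr_paths spin_adj n" "0 < n"
  shows "real n * spin_energy \<beta> (empirical_law n xs) =
    real n * (\<beta> / 2 * ((\<Sum>j<n. spin_product (xs ! j, xs ! (j + 1))) / real n)\<^sup>2)"
proof -
  have "graph_integral spin_adj spin_product (empirical_law n xs) =
      (\<Sum>j<n. spin_product (xs ! j, xs ! (j + 1))) / real n"
    unfolding graph_integral_empirical_law[OF assms, symmetric] using assms(2) by simp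
  then show ?thesis
    by (simp add: spin_energy_def)
qed

lemma exp_tilted_value:
  "exp (real n * tilted_value \<beta> c) =
     exp (- (real n * (\<beta> / 2 * c\<^sup>2))) * spin_lambda (\<beta> * c) ^ n"
proof -
  have "0 < spin_lambda (\<beta> * c)"
    using spin_lambda_gt_2[of "\<beta> * c"] by simp
  then have "spin_lambda (\<beta> * c) ^ n = exp (real n * ln (spin_lambda (\<beta> * c)))"
    by (simp add: exp_of_nat_mult)
  then show ?thesis
    by (simp add: tilted_value_def right_diff_distrib flip: exp_add)
qed

text \<open>
  Here \<open>?t c xs\<close> is the weight of the path \<open>xs\<close> tilted at correlation \<open>c\<close>.  It never exceeds the
  nonlinear weight of \<open>xs\<close> and equals it when \<open>c\<close> is the empirical correlation of \<open>xs\<close>.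
\<close>

lemma partition_sum_bounds:
  fixes n :: nat
  assumes "0 \<le> \<beta>" "0 < n"
  defines "W \<equiv> \<Sum>xs\<in>corr_paths spin_adj n. exp (real n * spin_energy \<beta> (empirical_law n xs))"
  shows "exp (real n * pressure_value \<beta>) \<le> W"
    and "W \<le> (2 * real n + 1) * ((spin_lambda \<beta> + 1) * exp (real n * pressure_value \<beta>))"
proof -
  let ?K = "\<lambda>xs. \<Sum>j<n. spin_product (xs ! j, xs ! (j + 1))"
  let ?P = "corr_paths spin_adj n"
  let ?I = "{- int n..int n}"
  let ?t = "\<lambda>c xs. exp (- (real n * (\<beta> / 2 * c\<^sup>2))) * exp (\<beta> * c * ?K xs)"
  have t: "?t c xs = exp (\<beta> * c * ?K xs - real n * (\<beta> / 2 * c\<^sup>2))" for c xs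
    by (simp flip: exp_add)
  have n: "real n \<noteq> 0" using assms(2) by simp
  \<comment> \<open>Completing the square: the difference of the exponents is \<open>n * \<beta> / 2 * (b - c)\<^sup>2\<close>.\<close>
  have lower: "?t c xs \<le> exp (real n * spin_energy \<beta> (empirical_law n xs))"
    if "xs \<in> ?P" for c xs
  proof -
    let ?b = "?K xs / real n"
    have "0 \<le> real n * (\<beta> / 2 * (?b - c)\<^sup>2)"
      using assms(1) by simp
    also have "\<dots> = real n * (\<beta> / 2 * ?b\<^sup>2) - (\<beta> * c * (real n * ?b) - real n * (\<beta> / 2 * c\<^sup>2))"
      by (simp only: power2_diff) (simp add: algebra_simps)
    also have "real n * ?b = ?K xs"
      using n by simp
    finally show ?thesis
      unfolding t spin_energy_empirical[OF that assms(2)] by simp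
  qed
  have "exp (real n * pressure_value \<beta>) \<le>
      (\<Sum>xs\<in>?P. ?t (spin_z (spin_branch \<beta>)) xs)"
    unfolding pressure_value_def exp_tilted_value sum_distrib_left[symmetric]
    by (intro mult_left_mono spin_path_sum_bounds) simp
  also have "\<dots> \<le> W"
    unfolding W_def by (intro sum_mono lower)
  finally show "exp (real n * pressure_value \<beta>) \<le> W" .

  \<comment> \<open>The summand for the actual value of the path sum already equals the left-hand side.\<close>
  have upper: "exp (real n * spin_energy \<beta> (empirical_law n xs)) \<le>
      (\<Sum>k\<in>?I. ?t (of_int k / real n) xs)" if xs: "xs \<in> ?P" for xs
  proof -
    obtain k where k: "k \<in> ?I" "?K xs = of_int k"
      using spin_product_sum_int[of n xs] .
    have "exp (real n * spin_energy \<beta> (empirical_law n xs)) = ?t (of_int k / real n) xs"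
      unfolding t unfolding spin_energy_empirical[OF xs assms(2)] k(2)
      by (rule arg_cong[of _ _ exp]) (use n in \<open>simp add: power2_eq_square field_simps\<close>)
    also have "\<dots> \<le> (\<Sum>k\<in>?I. ?t (of_int k / real n) xs)"
      by (rule member_le_sum[OF k(1)]) auto
    finally show ?thesis .
  qed
  have "W \<le> (\<Sum>xs\<in>?P. \<Sum>k\<in>?I. ?t (of_int k / real n) xs)"
    unfolding W_def by (intro sum_mono upper)
  also have "\<dots> = (\<Sum>k\<in>?I. \<Sum>xs\<in>?P. ?t (of_int k / real n) xs)"
    by (rule sum.swap)
  also have "\<dots> \<le> (\<Sum>k\<in>?I. (spin_lambda \<beta> + 1) * exp (real n * pressure_value \<beta>))"
  proof (rule sum_mono)
    fix k assume k: "k \<in> ?I"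
    let ?c = "of_int k / real n"
    have "\<bar>?c\<bar> \<le> 1"
      using k assms(2) by (simp add: abs_le_iff field_simps)
    then have "\<beta> * \<bar>?c\<bar> \<le> \<beta> * 1"
      using assms(1) by (rule mult_left_mono)
    then have "\<bar>\<beta> * ?c\<bar> \<le> \<beta>"
      using assms(1) by (simp add: abs_mult)
    then have lam: "spin_lambda (\<beta> * ?c) \<le> spin_lambda \<beta>"
      by (rule spin_lambda_mono)
    have "(\<Sum>xs\<in>?P. ?t ?c xs) \<le>
        exp (- (real n * (\<beta> / 2 * ?c\<^sup>2))) *
          ((spin_lambda (\<beta> * ?c) + 1) * spin_lambda (\<beta> * ?c) ^ n)"
      unfolding sum_distrib_left[symmetric] by (intro mult_left_mono spin_path_sum_bounds) simp
    also have "\<dots> = (spin_lambda (\<beta> * ?c) + 1) * exp (real n * tilted_value \<beta> ?c)"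
      unfolding exp_tilted_value by (simp only: mult_ac)
    also have "\<dots> \<le> (spin_lambda \<beta> + 1) * exp (real n * pressure_value \<beta>)"
      using lam spin_lambda_gt_2[of \<beta>] tilted_value_le(1)[OF assms(1)]
      by (intro mult_mono) (auto intro: mult_left_mono)
    finally show "(\<Sum>xs\<in>?P. ?t ?c xs) \<le> (spin_lambda \<beta> + 1) * exp (real n * pressure_value \<beta>)" .
  qed
  also have "\<dots> = (2 * real n + 1) * ((spin_lambda \<beta> + 1) * exp (real n * pressure_value \<beta>))"
    by simp
  finally show "W \<le> (2 * real n + 1) * ((spin_lambda \<beta> + 1) * exp (real n * pressure_value \<beta>))" .
qed

lemma spin_pressure_limit:
  assumes "0 \<le> \<beta>"
  shows "pressure_seq spin_adj (spin_energy \<beta>) \<longlonglongrightarrow> pressure_value \<beta>"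
proof -
  let ?C = "spin_lambda \<beta> + 1"
  have C: "0 < ?C" using spin_lambda_gt_2[of \<beta>] by simp
  have b: "pressure_value \<beta> \<le> pressure_seq spin_adj (spin_energy \<beta>) n \<and>
      pressure_seq spin_adj (spin_energy \<beta>) n \<le> pressure_value \<beta> + ln ((2 * real n + 1) * ?C) / real n"
    if n: "0 < n" for n
  proof -
    let ?W = "\<Sum>xs\<in>corr_paths spin_adj n. exp (real n * spin_energy \<beta> (empirical_law n xs))"
    note W = partition_sum_bounds[OF assms n]
    have pos: "0 < ?W"
      using W(1) by (rule less_le_trans[OF exp_gt_zero])
    have "real n * pressure_value \<beta> \<le> ln ?W"
      using W(1) pos by (simp add: ln_ge_iff)
    moreover have "ln ?W \<le> ln ((2 * real n + 1) * ?C * exp (real n * pressure_value \<beta>))"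
      using W(2) pos by (intro ln_mono) (simp_all add: mult.assoc)
    then have "ln ?W \<le> ln ((2 * real n + 1) * ?C) + real n * pressure_value \<beta>"
      using C by (subst (asm) ln_mult_pos) (auto intro!: mult_pos_pos add_nonneg_pos)
    ultimately show ?thesis
      using n unfolding pressure_seq_def by (simp add: field_simps)
  qed
  show ?thesis
  proof (rule tendsto_sandwich)
    show "(\<lambda>n. pressure_value \<beta>) \<longlonglongrightarrow> pressure_value \<beta>" by simp
    show "(\<lambda>n. pressure_value \<beta> + ln ((2 * real n + 1) * ?C) / real n) \<longlonglongrightarrow> pressure_value \<beta>"
      using C by real_asymp
  qed (use b in \<open>auto intro: eventually_mono[OF eventually_gt_at_top[of 0]]\<close>)
qed

lemma spin_pressure_eq:
  assumes "0 \<le> \<beta>"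
  shows "spin_pressure \<beta> = pressure_value \<beta>"
  unfolding spin_pressure_def nonlinear_pressure_def
  by (rule limI[OF spin_pressure_limit[OF assms]])

section \<open>Regularity of the pressure\<close>

text \<open>
  Applying the subgradient inequality in both directions confines the difference quotient between
  \<open>w x\<close> and \<open>w y\<close>.
\<close>

lemma has_real_derivative_subgradient:
  fixes f w :: "real \<Rightarrow> real"
  assumes sub: "\<And>x y. x \<in> S \<Longrightarrow> y \<in> S \<Longrightarrow> f x + (y - x) * w x \<le> f y"
    and w: "continuous_on S w" and x: "x \<in> S"
  shows "(f has_real_derivative w x) (at x within S)"
  unfolding has_field_derivative_iff
proof (rule tendsto_sandwich)
  have lim: "(w \<longlongrightarrow> w x) (at x within S)"
    using w x by (simp add: continuous_on_def)
  show "((\<lambda>y. min (w x) (w y)) \<longlongrightarrow> w x) (at x within S)"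
    using tendsto_min[OF tendsto_const lim, of "w x"] by simp
  show "((\<lambda>y. max (w x) (w y)) \<longlongrightarrow> w x) (at x within S)"
    using tendsto_max[OF tendsto_const lim, of "w x"] by simp
  have slope: "min (w x) (w y) \<le> (f y - f x) / (y - x) \<and> (f y - f x) / (y - x) \<le> max (w x) (w y)"
    if y: "y \<in> S" "y \<noteq> x" for y
  proof (cases "x < y")
    case True
    have "w x * (y - x) \<le> f y - f x" "f y - f x \<le> w y * (y - x)"
      using sub[OF x y(1)] sub[OF y(1) x] by (simp_all add: algebra_simps)
    then have "w x \<le> (f y - f x) / (y - x)" "(f y - f x) / (y - x) \<le> w y"
      using True by (simp_all add: pos_le_divide_eq pos_divide_le_eq)
    then show ?thesis by auto
  next
    case False
    then have "y < x" using y(2) by simp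
    have "f y - f x \<le> w y * (y - x)" "w x * (y - x) \<le> f y - f x"
      using sub[OF x y(1)] sub[OF y(1) x] by (simp_all add: algebra_simps)
    then have "w y \<le> (f y - f x) / (y - x)" "(f y - f x) / (y - x) \<le> w x"
      using \<open>y < x\<close> by (simp_all add: neg_le_divide_eq neg_divide_le_eq)
    then show ?thesis by auto
  qed
  show "\<forall>\<^sub>F y in at x within S. min (w x) (w y) \<le> (f y - f x) / (y - x)"
    "\<forall>\<^sub>F y in at x within S. (f y - f x) / (y - x) \<le> max (w x) (w y)"
    using slope by (simp_all add: eventually_at_filter)
qed

text \<open>The derivative of the pressure, by the envelope argument below.\<close>

definition pressure_slope :: "real \<Rightarrow> real" where
  "pressure_slope \<beta> = (spin_z (spin_branch \<beta>))\<^sup>2 / 2"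

text \<open>
  The equilibrium pair at \<open>a\<close> competes at \<open>b\<close>, and its nonlinear value is affine in the inverse
  temperature.
\<close>

lemma pressure_subgradient:
  assumes "0 \<le> a" "0 \<le> b"
  shows "spin_pressure a + (b - a) * pressure_slope a \<le> spin_pressure b"
proof -
  let ?p = "spin_pair (spin_branch a)"
  have e: "spin_energy \<beta> (two_coordinate_law ?p) = \<beta> * pressure_slope a" for \<beta>
    using correlation_spin_pair[of "spin_branch a"]
    by (simp add: spin_energy_def correlation_def pressure_slope_def)
  have "entropy_rate ?p + spin_energy a (two_coordinate_law ?p) = spin_pressure a"
    using nonlinear_value_spin_pair[of "spin_branch a" a] spin_branch_nonneg[of a] assms(1)
    by (simp add: spin_pressure_eq)
  moreover have "entropy_rate ?p + spin_energy b (two_coordinate_law ?p) \<le> spin_pressure b"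
    using nonlinear_value_le(1)[OF assms(2) stationary_spin_pair] assms(2)
    by (simp add: spin_pressure_eq)
  ultimately show ?thesis
    by (simp add: e algebra_simps)
qed

lemma continuous_on_pressure_slope: "continuous_on {0..} pressure_slope"
proof -
  have "continuous_on UNIV spin_z"
    by (intro continuous_at_imp_continuous_on ballI DERIV_isCont[OF spin_z_deriv])
  from continuous_on_compose2[OF this continuous_on_spin_branch] show ?thesis
    unfolding pressure_slope_def[abs_def] by (intro continuous_intros) simp_all
qed

lemma spin_pressure_deriv:
  assumes "0 \<le> \<beta>"
  shows "(spin_pressure has_real_derivative pressure_slope \<beta>) (at \<beta> within {0..})"
  using assms
  by (intro has_real_derivative_subgradient continuous_on_pressure_slope pressure_subgradient) auto

lemma C1_spin_pressure: "C_k_on 1 spin_pressure {0..}"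
  using spin_pressure_deriv continuous_on_pressure_slope by auto

lemma filterlim_spin_branch: "filterlim spin_branch (at_right 0) (at_right (sqrt 3))"
proof -
  have "(spin_branch \<longlongrightarrow> spin_branch (sqrt 3)) (at (sqrt 3) within {0..})"
    using continuous_on_spin_branch by (simp add: continuous_on_def)
  then have "(spin_branch \<longlongrightarrow> spin_branch (sqrt 3)) (at_right (sqrt 3))"
    by (rule tendsto_within_subset) (auto dest: pos_if_sqrt3_less)
  moreover have "\<forall>\<^sub>F \<beta> in at_right (sqrt 3). 0 < spin_branch \<beta>"
    using eventually_at_right_less[of "sqrt 3"]
    by eventually_elim
      (use self_consistent_y_sol in \<open>auto simp: spin_branch_def self_consistent_iff\<close>)
  ultimately show ?thesis
    by (simp add: filterlim_at spin_branch_def eventually_mono less_imp_neq)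
qed

text \<open>
  Along the branch \<open>spin_z Y / Y = 1 / \<beta>\<close>, so the expansion of \<open>spin_z y / y\<close> at \<open>0\<close> becomes one of
  \<open>1 - sqrt 3 / \<beta>\<close> in terms of \<open>Y\<close>.
\<close>

lemma spin_z_branch_limit:
  "((\<lambda>\<beta>. spin_z (y_sol \<beta>) / (\<beta> - sqrt 3) powr (1 / 4)) \<longlongrightarrow> (10 * sqrt 3) powr (1 / 4) / sqrt 3)
     (at_right (sqrt 3))"
proof -
  let ?F = "at_right (sqrt 3)"
  have ev: "\<forall>\<^sub>F \<beta> in ?F. sqrt 3 < \<beta>"
    by (rule eventually_at_right_less)
  have "((\<lambda>\<beta>. (1 - sqrt 3 * spin_z (spin_branch \<beta>) / spin_branch \<beta>) / spin_branch \<beta> ^ 4)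
      \<longlongrightarrow> 1 / 30) ?F"
    by (rule filterlim_compose[OF spin_z_ratio_expansion filterlim_spin_branch])
  then have "((\<lambda>\<beta>. inverse ((1 - sqrt 3 * spin_z (spin_branch \<beta>) / spin_branch \<beta>) /
      spin_branch \<beta> ^ 4) / \<beta>) \<longlongrightarrow> inverse (1 / 30) / sqrt 3) ?F"
    by (intro tendsto_divide[OF tendsto_inverse] tendsto_ident_at) auto
  also have "inverse (1 / 30) / sqrt 3 = 10 * sqrt 3"
    by (simp add: field_simps)
  finally have "((\<lambda>\<beta>. inverse ((1 - sqrt 3 * spin_z (spin_branch \<beta>) / spin_branch \<beta>) /
      spin_branch \<beta> ^ 4) / \<beta>) \<longlongrightarrow> 10 * sqrt 3) ?F" .
  then have "((\<lambda>\<beta>. (inverse ((1 - sqrt 3 * spin_z (spin_branch \<beta>) / spin_branch \<beta>) /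
      spin_branch \<beta> ^ 4) / \<beta>) powr (1 / 4) * (spin_z (spin_branch \<beta>) / spin_branch \<beta>))
      \<longlongrightarrow> (10 * sqrt 3) powr (1 / 4) * (1 / sqrt 3)) ?F"
    by (intro tendsto_intros filterlim_compose[OF spin_z_ratio_limit filterlim_spin_branch]) auto
  moreover have "\<forall>\<^sub>F \<beta> in ?F.
      (inverse ((1 - sqrt 3 * spin_z (spin_branch \<beta>) / spin_branch \<beta>) /
      spin_branch \<beta> ^ 4) / \<beta>) powr (1 / 4) * (spin_z (spin_branch \<beta>) / spin_branch \<beta>) =
      spin_z (y_sol \<beta>) / (\<beta> - sqrt 3) powr (1 / 4)"
    using ev
  proof eventually_elim
    case (elim \<beta>)
    let ?Y = "spin_branch \<beta>"
    have b: "0 < \<beta>" using elim by (rule pos_if_sqrt3_less)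
    have Y: "0 < ?Y" "?Y = y_sol \<beta>"
      using self_consistent_y_sol[OF elim] elim by (auto simp: self_consistent_iff spin_branch_def)
    have "sqrt 3 * spin_z ?Y / ?Y = sqrt 3 / \<beta>"
      using spin_branch_fixed[of \<beta>] Y(1) b by (simp add: frac_eq_eq mult_ac)
    then have "1 - sqrt 3 * spin_z ?Y / ?Y = (\<beta> - sqrt 3) / \<beta>"
      using b by (simp add: diff_divide_distrib)
    then have "inverse ((1 - sqrt 3 * spin_z ?Y / ?Y) / ?Y ^ 4) / \<beta> = ?Y ^ 4 / (\<beta> - sqrt 3)"
      using Y(1) b elim by simp
    also have "\<dots> powr (1 / 4) = (?Y ^ 4) powr (1 / 4) / (\<beta> - sqrt 3) powr (1 / 4)"
      by (rule powr_divide)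
    also have "(?Y ^ 4) powr (1 / 4) = (?Y powr 4) powr (1 / 4)"
      using Y(1) by (simp only: powr_numeral less_imp_le)
    also have "\<dots> = ?Y"
      unfolding powr_powr using Y(1) by simp
    finally show ?case
      using Y by simp
  qed
  ultimately show ?thesis
    by (simp add: tendsto_cong)
qed

lemma spin_z_asymp_equiv:
  "(\<lambda>\<beta>. spin_z (y_sol \<beta>)) \<sim>[at_right (sqrt 3)]
     (\<lambda>\<beta>. (10 * sqrt 3) powr (1 / 4) / sqrt 3 * (\<beta> - sqrt 3) powr (1 / 4))"
proof (rule asymp_equivI')
  let ?C = "(10 * sqrt 3) powr (1 / 4) / sqrt 3"
  have "((\<lambda>\<beta>. spin_z (y_sol \<beta>) / (\<beta> - sqrt 3) powr (1 / 4) / ?C) \<longlongrightarrow> ?C / ?C) (at_right (sqrt 3))"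
    by (intro tendsto_intros spin_z_branch_limit) simp
  then show "((\<lambda>\<beta>. spin_z (y_sol \<beta>) / (?C * (\<beta> - sqrt 3) powr (1 / 4))) \<longlongrightarrow> 1)
      (at_right (sqrt 3))"
    by (simp add: mult_ac)
qed

lemma pressure_slope_blowup:
  "filterlim (\<lambda>\<beta>. (pressure_slope \<beta> - pressure_slope (sqrt 3)) / (\<beta> - sqrt 3)) at_top
     (at_right (sqrt 3))"
proof -
  let ?F = "at_right (sqrt 3)" and ?C = "(10 * sqrt 3) powr (1 / 4) / sqrt 3"
  have "((\<lambda>\<beta>. (spin_z (y_sol \<beta>) / (\<beta> - sqrt 3) powr (1 / 4))\<^sup>2 / 2) \<longlongrightarrow> ?C\<^sup>2 / 2) ?F"
    by (intro tendsto_intros spin_z_branch_limit) simp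
  moreover have "filterlim (\<lambda>\<beta>. (\<beta> - sqrt 3) powr (- 1 / 2)) at_top ?F"
    by real_asymp
  ultimately have "filterlim (\<lambda>\<beta>. (spin_z (y_sol \<beta>) / (\<beta> - sqrt 3) powr (1 / 4))\<^sup>2 / 2 *
      (\<beta> - sqrt 3) powr (- 1 / 2)) at_top ?F"
    by (intro filterlim_tendsto_pos_mult_at_top[where c = "?C\<^sup>2 / 2"]) simp_all
  moreover have "\<forall>\<^sub>F \<beta> in ?F. (spin_z (y_sol \<beta>) / (\<beta> - sqrt 3) powr (1 / 4))\<^sup>2 / 2 *
      (\<beta> - sqrt 3) powr (- 1 / 2) =
      (pressure_slope \<beta> - pressure_slope (sqrt 3)) / (\<beta> - sqrt 3)"
    using eventually_at_right_less[of "sqrt 3"]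
  proof eventually_elim
    case (elim \<beta>)
    let ?p = "(\<beta> - sqrt 3) powr (1 / 4)" and ?q = "(\<beta> - sqrt 3) powr (- 1 / 2)"
    have "?p\<^sup>2 = (\<beta> - sqrt 3) powr (1 / 2)"
      by (simp add: power2_eq_square flip: powr_add)
    then have q: "?q / ?p\<^sup>2 = 1 / (\<beta> - sqrt 3)"
      using elim by (simp add: powr_minus_divide flip: powr_add)
    have "(spin_z (y_sol \<beta>) / ?p)\<^sup>2 / 2 * ?q = (spin_z (y_sol \<beta>))\<^sup>2 / 2 * (?q / ?p\<^sup>2)"
      by (simp add: power_divide)
    also have "\<dots> = (pressure_slope \<beta> - pressure_slope (sqrt 3)) / (\<beta> - sqrt 3)"
      unfolding q using elim by (simp add: pressure_slope_def spin_branch_def)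
    finally show ?case .
  qed
  ultimately show ?thesis
    using filterlim_cong[OF refl refl] by fast
qed

lemma not_C2_spin_pressure: "\<not> C_k_at 2 spin_pressure (sqrt 3)"
proof
  assume "C_k_at 2 spin_pressure (sqrt 3)"
  then obtain U where U: "open U" "sqrt 3 \<in> U" and C2: "C_k_on (Suc (Suc 0)) spin_pressure U"
    unfolding C_k_at_def numeral_2_eq_2 by blast
  from C2 obtain f' f'' where
    f': "\<And>x. x \<in> U \<Longrightarrow> (spin_pressure has_real_derivative f' x) (at x within U)"
    and f'': "\<And>x. x \<in> U \<Longrightarrow> (f' has_real_derivative f'' x) (at x within U)"
    unfolding C_k_on.simps by blast
  have eq: "f' x = pressure_slope x" if "x \<in> U" "0 < x" for x
  proof -
    have "(spin_pressure has_real_derivative f' x) (at x)"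
      using f'[OF that(1)] unfolding at_within_open[OF that(1) U(1)] .
    moreover have int: "x \<in> interior {0..}"
      using that(2) by (simp add: interior_real_atLeast)
    have "(spin_pressure has_real_derivative pressure_slope x) (at x)"
      using spin_pressure_deriv[OF less_imp_le[OF that(2)]] unfolding at_within_interior[OF int] .
    ultimately show ?thesis
      by (rule DERIV_unique)
  qed
  have "(f' has_real_derivative f'' (sqrt 3)) (at (sqrt 3) within U)"
    by (rule f''[OF U(2)])
  then have "((\<lambda>x. (f' x - f' (sqrt 3)) / (x - sqrt 3)) \<longlongrightarrow> f'' (sqrt 3)) (at (sqrt 3))"
    unfolding has_field_derivative_iff at_within_open[OF U(2,1)] .
  then have "((\<lambda>x. (f' x - f' (sqrt 3)) / (x - sqrt 3)) \<longlongrightarrow> f'' (sqrt 3)) (at_right (sqrt 3))"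
    by (rule tendsto_within_subset) simp
  moreover have "\<forall>\<^sub>F x in at_right (sqrt 3). x \<in> U"
    using eventually_at_in_open'[OF U] unfolding eventually_at_filter by (rule eventually_mono) simp
  with eventually_at_right_less[of "sqrt 3"]
  have "\<forall>\<^sub>F x in at_right (sqrt 3). (f' x - f' (sqrt 3)) / (x - sqrt 3) =
      (pressure_slope x - pressure_slope (sqrt 3)) / (x - sqrt 3)"
  proof eventually_elim
    case (elim x)
    then have "0 < x" using pos_if_sqrt3_less by blast
    then show ?case
      using elim eq U(2) by simp
  qed
  ultimately have "((\<lambda>x. (pressure_slope x - pressure_slope (sqrt 3)) / (x - sqrt 3))
      \<longlongrightarrow> f'' (sqrt 3)) (at_right (sqrt 3))"
    by (simp add: tendsto_cong)
  then show False
    using not_tendsto_and_filterlim_at_infinity[OF trivial_limit_at_right_real _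
        filterlim_at_top_imp_at_infinity[OF pressure_slope_blowup]] by blast
qed

theorem proposition7p9:
  shows
    "(\<forall>b. critical_inverse_temperature spin_adj spin_energy b \<longleftrightarrow> b = sqrt 3) \<and>
     (\<forall>y. only_pair (linear_equilibrium_pair spin_adj (\<lambda>e. y * spin_product e)) (spin_pair y)) \<and>
     (\<forall>\<beta>. 0 \<le> \<beta> \<and> \<beta> \<le> sqrt 3 \<longrightarrow>
        only_pair (equilibrium_pair spin_adj (spin_energy \<beta>)) (spin_pair 0) \<and>
        correlation (spin_pair 0) = 0) \<and>
     (\<forall>\<beta>. \<beta> > sqrt 3 \<longrightarrow>
        (\<exists>!y. self_consistent \<beta> y) \<and>
        only_two_pairs (equilibrium_pair spin_adj (spin_energy \<beta>))
          (spin_pair (y_sol \<beta>)) (spin_pair (- y_sol \<beta>)) \<and>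
        correlation (spin_pair (y_sol \<beta>)) = spin_z (y_sol \<beta>) \<and>
        correlation (spin_pair (- y_sol \<beta>)) = - spin_z (y_sol \<beta>) \<and>
        spin_measure (y_sol \<beta>) = spin_measure (- y_sol \<beta>) \<and>
        two_coordinate_law (spin_pair (y_sol \<beta>)) \<noteq>
          two_coordinate_law (spin_pair (- y_sol \<beta>))) \<and>
     (\<forall>\<beta>\<ge>0. convergent (pressure_seq spin_adj (spin_energy \<beta>)) \<and>
        spin_pressure \<beta> =
          (if \<beta> \<le> sqrt 3 then ln (1 + sqrt 3)
           else ln (spin_lambda (y_sol \<beta>)) - \<beta> / 2 * (spin_z (y_sol \<beta>))\<^sup>2)) \<and>
     (\<lambda>\<beta>. spin_z (y_sol \<beta>)) \<sim>[at_right (sqrt 3)]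
       (\<lambda>\<beta>. (10 * sqrt 3) powr (1 / 4) / sqrt 3 * (\<beta> - sqrt 3) powr (1 / 4)) \<and>
     C_k_on 1 spin_pressure {0..} \<and>
     \<not> C_k_at 2 spin_pressure (sqrt 3)"
proof (intro conjI allI impI)
  fix b
  show "critical_inverse_temperature spin_adj spin_energy b \<longleftrightarrow> b = sqrt 3"
    by (rule critical_inverse_temperature_spin)
next
  fix \<beta> :: real assume "0 \<le> \<beta> \<and> \<beta> \<le> sqrt 3"
  then show "only_pair (equilibrium_pair spin_adj (spin_energy \<beta>)) (spin_pair 0)"
    using unique_equilibrium by blast
next
  fix \<beta> :: real assume b: "\<beta> > sqrt 3"
  then show "two_coordinate_law (spin_pair (y_sol \<beta>)) \<noteq> two_coordinate_law (spin_pair (- y_sol \<beta>))"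
    using self_consistent_y_sol spin_pair_laws_differ by (simp add: self_consistent_iff)
next
  fix \<beta> :: real assume b: "0 \<le> \<beta>"
  show "convergent (pressure_seq spin_adj (spin_energy \<beta>))"
    using spin_pressure_limit[OF b] by (rule convergentI)
qed (simp_all only: only_linear_equilibrium_spin_pair ex1_self_consistent two_equilibria
    correlation_spin_pair spin_z_0 spin_z_minus spin_measure_minus spin_pressure_eq
    pressure_value_eq spin_z_asymp_equiv C1_spin_pressure not_C2_spin_pressure not_False_eq_True)

end
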